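(* Let $d\in\mathbb{N}$, $\delta\in(0,1)$, and let $m,n\in\mathbb{N}=\{1,2,\dots\}$ be such that $$m=\left\lfloor\frac{n}{48(\sqrt{2}\ln(2n)-\ln\delta)}\right\rfloor .$$ Then $$e^{\rm ran}(n,d;\Lambda^{\rm std})\le\Big(1+\frac{4m}{n}\Big)^{\frac12}\frac{1}{\sqrt{1-\delta}}\;e^{\rm wor}(m,d;\Lambda^{\rm all}).$$
   Context: Setting. For each $d\in\mathbb{N}$, $D_d\subset\mathbb{R}^d$ is a Borel measurable set of positive Lebesgue measure, $\rho_d$ is a probability density function on $D_d$, $G_d=L_2(D_d,\rho_d(x)\,dx)$, and $F_d$ is a separable Hilbert space of functions on $D_d$ that is compactly embedded in $G_d$; ${\rm APP}_d:F_d\to G_d$, ${\rm APP}_d f=f$, is the compact embedding operator. Information. $\Lambda^{\rm all}$ is the extended class of all linear functionals (not necessarily continuous), and $\Lambda^{\rm std}\subset\Lambda^{\rm all}$ is the extended class of all function values $f\mapsto f(x)$, $x\in D_d$ (defined only almost everywhere). Worst case setting. Deterministic algorithms have the form $A_{n,d}f=\phi_{n,d}(L_1(f),\dots,L_n(f))$ with linear functionals $L_1,\dots,L_n\in\Lambda^{\rm all}$ and an arbitrary measurable mapping $\phi_{n,d}:\mathbb{R}^n\to G_d$. Define $$e^{\rm wor}(A_{n,d})=\sup_{\|f\|_{F_d}\le1}\|{\rm APP}_d f-A_{n,d}f\|_{G_d},\qquad e^{\rm wor}(n,d;\Lambda^{\rm all})=\inf_{A_{n,d}}e^{\rm wor}(A_{n,d}),$$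 the infimum being over all such algorithms. Randomized setting. For $\Lambda\in\{\Lambda^{\rm all},\Lambda^{\rm std}\}$, randomized algorithms have the form $A_{n,d}^\omega(f)=\phi_{n,d,\omega}(L_{1,\omega}(f),\dots,L_{n,\omega}(f))$ with $L_{j,\omega}\in\Lambda$, where $\phi_{n,d,\omega}$ and $L_{j,\omega}$ may be randomly selected according to some probability space $(\Omega,\Sigma,\mathcal P)$; for each fixed $\omega$ the algorithm is a deterministic method with cardinality $n=n(f,\omega)$, which may be random and may depend adaptively on the input. Its cardinality is ${\rm Card}(A_{n,d}^\omega)=\sup_{\|f\|_{F_d}\le1}\mathbb{E}_\omega n(f,\omega)$ and its error is $$e^{\rm ran}(A_{n,d}^\omega)=\sup_{\|f\|_{F_d}\le1}\Big(\mathbb{E}_\omega\|{\rm APP}_d f-A_{n,d}^\omega(f)\|_{G_d}^2\Big)^{1/2}.$$ Define $e^{\rm ran}(n,d;\Lambda)=\inf e^{\rm ran}(A_{n,d}^\omega)$, the infimum being over all such algorithms using information from $\Lambda$ with ${\rm Card}(A_{n,d}^\omega)\le n$. $\lfloor x\rfloor$ is the largest integer not exceeding $x$. *)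

theory Defs
  imports "HOL-Probability.Probability"
begin

section \<open>The target space $G = L_2(D, \rho(x)\,dx)$\<close>

definition weighted_measure :: "(real ^ 'd) set \<Rightarrow> (real ^ 'd \<Rightarrow> real) \<Rightarrow> (real ^ 'd) measure" where
  "weighted_measure D \<rho> = density (lebesgue_on D) (\<lambda>x. ennreal (\<rho> x))"

text \<open>
  Elements of $L_2$ are represented by square-integrable functions; equality of elements is
  equality almost everywhere, i.e. \<open>L2_dist \<mu> g h = 0\<close>.
\<close>

definition L2 :: "'a measure \<Rightarrow> ('a \<Rightarrow> real) set" where
  "L2 \<mu> = {g. g \<in> borel_measurable \<mu> \<and> integrable \<mu> (\<lambda>x. (g x)\<^sup>2)}"

definition L2_dist :: "'a measure \<Rightarrow> ('a \<Rightarrow> real) \<Rightarrow> ('a \<Rightarrow> real) \<Rightarrow> real" where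
  "L2_dist \<mu> g h = sqrt (\<integral>x. (g x - h x)\<^sup>2 \<partial>\<mu>)"

definition L2_open :: "'a measure \<Rightarrow> ('a \<Rightarrow> real) set \<Rightarrow> bool" where
  "L2_open \<mu> U \<longleftrightarrow> U \<subseteq> L2 \<mu> \<and>
     (\<forall>g\<in>U. \<exists>\<epsilon>>0. \<forall>h\<in>L2 \<mu>. L2_dist \<mu> g h < \<epsilon> \<longrightarrow> h \<in> U)"

text \<open>
  The Borel \<open>\<sigma>\<close>-algebra of $L_2$. An \<open>L2_open\<close> set is closed under almost everywhere equality,
  so this is the Borel \<open>\<sigma>\<close>-algebra of the quotient, pulled back to representatives.
\<close>

definition L2_borel :: "'a measure \<Rightarrow> ('a \<Rightarrow> real) measure" where
  "L2_borel \<mu> = sigma (L2 \<mu>) {U. L2_open \<mu> U}"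


section \<open>The source space $F$ and its compact embedding into $G$\<close>

text \<open>
  The Hilbert space $F$ is a type \<open>'f\<close> of class \<open>{real_inner, complete_space}\<close>, together with a
  map \<open>APP\<close> that sends \<open>f\<close> to the function on \<open>D\<close> it stands for; read as a map into \<open>L2\<close>,
  this is the embedding operator. Since functions need only be defined almost everywhere,
  \<open>APP f\<close> may be any representative of \<open>f\<close>, and \<open>APP\<close> is linear and injective up to null sets.
  A space of genuine functions, for which \<open>APP\<close> is linear at every point, is a special case.
\<close>

definition compact_embedding ::
  "'a measure \<Rightarrow> ('f::{real_inner, complete_space} \<Rightarrow> 'a \<Rightarrow> real) \<Rightarrow> bool" where
  "compact_embedding \<mu> APP \<longleftrightarrow>
     (\<forall>f. APP f \<in> L2 \<mu>) \<and>
     (\<forall>f g. AE x in \<mu>. APP (f + g) x = APP f x + APP g x) \<and>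
     (\<forall>c f. AE x in \<mu>. APP (c *\<^sub>R f) x = c * APP f x) \<and>
     (\<forall>f. (AE x in \<mu>. APP f x = 0) \<longrightarrow> f = 0) \<and>
     (\<forall>u :: nat \<Rightarrow> 'f. bounded (range u) \<longrightarrow>
        (\<exists>g\<in>L2 \<mu>. \<exists>r. strict_mono r \<and> (\<lambda>k. L2_dist \<mu> (APP (u (r k))) g) \<longlonglongrightarrow> 0))"

definition approximation_setting ::
  "(real ^ 'd) set \<Rightarrow> (real ^ 'd \<Rightarrow> real) \<Rightarrow>
   ('f::{real_inner, complete_space} \<Rightarrow> real ^ 'd \<Rightarrow> real) \<Rightarrow> bool" where
  "approximation_setting D \<rho> APP \<longleftrightarrow>
     D \<in> sets borel \<and> 0 < emeasure lborel D \<and>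
     \<rho> \<in> borel_measurable (lebesgue_on D) \<and> (\<forall>x\<in>D. 0 \<le> \<rho> x) \<and>
     (\<integral>\<^sup>+x. ennreal (\<rho> x) \<partial>lebesgue_on D) = 1 \<and>
     separable_space (euclidean :: 'f topology) \<and>
     compact_embedding (weighted_measure D \<rho>) APP"


section \<open>Information\<close>

definition Lambda_all :: "('f::real_vector \<Rightarrow> real) set" where
  "Lambda_all = {L. linear L}"

definition Lambda_std :: "'a set \<Rightarrow> ('f \<Rightarrow> 'a \<Rightarrow> real) \<Rightarrow> ('f \<Rightarrow> real) set" where
  "Lambda_std D APP = {\<lambda>f. APP f x |x. x \<in> D}"

text \<open>
  The vector $(L_1(f),\dots,L_k(f))$; here and below functionals are numbered from 0, and $R^k$ is
  the product of \<open>k\<close> copies of \<open>borel\<close> over the index set \<open>{..<k}\<close>.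
\<close>

definition info :: "(nat \<Rightarrow> 'f \<Rightarrow> real) \<Rightarrow> nat \<Rightarrow> 'f \<Rightarrow> nat \<Rightarrow> real" where
  "info L k f = (\<lambda>j\<in>{..<k}. L j f)"

abbreviation borel_vec :: "nat \<Rightarrow> (nat \<Rightarrow> real) measure" where
  "borel_vec k \<equiv> (\<Pi>\<^sub>M j\<in>{..<k}. (borel :: real measure))"


section \<open>Worst case setting\<close>

definition wor_error ::
  "'a measure \<Rightarrow> ('f::real_normed_vector \<Rightarrow> 'a \<Rightarrow> real) \<Rightarrow> ('f \<Rightarrow> 'a \<Rightarrow> real) \<Rightarrow> ennreal" where
  "wor_error \<mu> APP A = (SUP f\<in>{f. norm f \<le> 1}. ennreal (L2_dist \<mu> (APP f) (A f)))"

definition e_wor ::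
  "'a measure \<Rightarrow> ('f::real_normed_vector \<Rightarrow> 'a \<Rightarrow> real) \<Rightarrow> nat \<Rightarrow> ('f \<Rightarrow> real) set \<Rightarrow> ennreal" where
  "e_wor \<mu> APP n \<Lambda> =
     Inf {wor_error \<mu> APP (\<lambda>f. \<phi> (info L n f)) |L \<phi>.
            (\<forall>j<n. L j \<in> \<Lambda>) \<and> \<phi> \<in> borel_vec n \<rightarrow>\<^sub>M L2_borel \<mu>}"


section \<open>Randomized setting\<close>

text \<open>
  For fixed \<open>\<omega>\<close>, the functionals \<open>ran_func \<omega> 0\<close>, \<open>ran_func \<omega> 1\<close>, \dots are evaluated one after
  another; after \<open>k\<close> evaluations the rule \<open>ran_stop \<omega> k\<close> decides, from the \<open>k\<close> values seen so far
  and nothing else, whether to stop, and then \<open>ran_recon \<omega> k\<close> produces the output. Thus the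
  cardinality depends on \<open>f\<close> adaptively.
\<close>

record ('w, 'a, 'f) ran_alg =
  ran_space :: "'w measure"
  ran_func :: "'w \<Rightarrow> nat \<Rightarrow> 'f \<Rightarrow> real"
  ran_stop :: "'w \<Rightarrow> nat \<Rightarrow> (nat \<Rightarrow> real) \<Rightarrow> bool"
  ran_recon :: "'w \<Rightarrow> nat \<Rightarrow> (nat \<Rightarrow> real) \<Rightarrow> 'a \<Rightarrow> real"

definition ran_n :: "('w, 'a, 'f) ran_alg \<Rightarrow> 'f \<Rightarrow> 'w \<Rightarrow> nat" where
  "ran_n A f \<omega> = (LEAST k. ran_stop A \<omega> k (info (ran_func A \<omega>) k f))"

definition ran_output :: "('w, 'a, 'f) ran_alg \<Rightarrow> 'w \<Rightarrow> 'f \<Rightarrow> 'a \<Rightarrow> real" where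
  "ran_output A \<omega> f =
     ran_recon A \<omega> (ran_n A f \<omega>) (info (ran_func A \<omega>) (ran_n A f \<omega>) f)"

text \<open>The last two conditions make the expectations in the cardinality and the error meaningful.\<close>

definition ran_algorithm ::
  "'a measure \<Rightarrow> ('f \<Rightarrow> 'a \<Rightarrow> real) \<Rightarrow> ('f \<Rightarrow> real) set \<Rightarrow> ('w, 'a, 'f) ran_alg \<Rightarrow> bool" where
  "ran_algorithm \<mu> APP \<Lambda> A \<longleftrightarrow>
     prob_space (ran_space A) \<and>
     (\<forall>\<omega>\<in>space (ran_space A). \<forall>j. ran_func A \<omega> j \<in> \<Lambda>) \<and>
     (\<forall>\<omega>\<in>space (ran_space A). \<forall>k. ran_recon A \<omega> k \<in> borel_vec k \<rightarrow>\<^sub>M L2_borel \<mu>) \<and>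
     (\<forall>\<omega>\<in>space (ran_space A). \<forall>f. \<exists>k. ran_stop A \<omega> k (info (ran_func A \<omega>) k f)) \<and>
     (\<forall>f. ran_n A f \<in> ran_space A \<rightarrow>\<^sub>M count_space UNIV) \<and>
     (\<forall>f. (\<lambda>\<omega>. L2_dist \<mu> (APP f) (ran_output A \<omega> f)) \<in> borel_measurable (ran_space A))"

definition ran_card :: "('w, 'a, 'f::real_normed_vector) ran_alg \<Rightarrow> ennreal" where
  "ran_card A = (SUP f\<in>{f. norm f \<le> 1}. \<integral>\<^sup>+\<omega>. ennreal (real (ran_n A f \<omega>)) \<partial>ran_space A)"

definition ennsqrt :: "ennreal \<Rightarrow> ennreal" where
  "ennsqrt x = (if x = \<top> then \<top> else ennreal (sqrt (enn2real x)))"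

definition ran_error ::
  "'a measure \<Rightarrow> ('f::real_normed_vector \<Rightarrow> 'a \<Rightarrow> real) \<Rightarrow> ('w, 'a, 'f) ran_alg \<Rightarrow> ennreal" where
  "ran_error \<mu> APP A =
     (SUP f\<in>{f. norm f \<le> 1}.
        ennsqrt (\<integral>\<^sup>+\<omega>. ennreal ((L2_dist \<mu> (APP f) (ran_output A \<omega> f))\<^sup>2) \<partial>ran_space A))"

text \<open>
  The infimum ranges over all probability spaces whose points are sequences in the domain type.
  An infimum over probability spaces on all types is not expressible; enlarging the range could
  only decrease \<open>e_ran\<close>, so upper bounds for \<open>e_ran\<close> hold for any larger range as well.
\<close>

definition e_ran ::
  "'a measure \<Rightarrow> ('f::real_normed_vector \<Rightarrow> 'a \<Rightarrow> real) \<Rightarrow> nat \<Rightarrow> ('f \<Rightarrow> real) set \<Rightarrow> ennreal" where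
  "e_ran \<mu> APP n \<Lambda> =
     Inf {ran_error \<mu> APP A |A :: (nat \<Rightarrow> 'a, 'a, 'f) ran_alg.
            ran_algorithm \<mu> APP \<Lambda> A \<and> ran_card A \<le> ennreal (real n)}"

end

theory Submission
  imports Defs
begin

text \<open>
  The bound is proved with a linear randomized algorithm: sample \<open>n\<close> points one after another and
  correct the current approximation by a multiple of a kernel function each time. All estimates
  are second moment computations.

  \<^emph>\<open>What deterministic methods cannot beat.\<close> Let \<open>T\<close> be the embedding and \<open>v\<^sub>0, v\<^sub>1, \<dots>\<close> its right
  singular vectors, each a maximiser of \<open>\<parallel>T f\<parallel>\<close> on the part of the unit ball that is orthogonal to
  the previous ones (\<open>singular_system_exists\<close>). Any \<open>m\<close> linear functionals
  annihilate some nonzero vector in the span of \<open>v\<^sub>0, \<dots>, v\<^sub>m\<close> and therefore cannot tell it from its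
  negative; so the
  \<open>(m + 1)\<close>-st singular value is at most the worst case error (\<open>singular_value_le_e_wor\<close>). Hence there is
  a subspace \<open>V\<close> of \<open>L2\<close> of some dimension \<open>k\<close> with \<open>1 \<le> k \<le> m\<close>, such that the orthogonal projection
  onto \<open>V\<close> has at most that error on the unit ball (\<open>near_optimal_subspace\<close>). Write \<open>g\<close> for
  the component of \<open>f\<close> orthogonal to \<open>V\<close>.

  \<^emph>\<open>How to get close to the projection by sampling.\<close> Let \<open>K\<close> be the reproducing kernel of \<open>V\<close>, and draw
  \<open>x\<close> with density \<open>K x x / k\<close>. The step
  \<open>r \<mapsto> r - a (r x / K x x) K x\<close> for the residual \<open>r\<close> is a randomized Kaczmarz step. It leaves \<open>g\<close> alone,
  contracts the component in \<open>V\<close>, and adds noise of order \<open>a\<^sup>2 \<parallel>r\<parallel>\<^sup>2 / k\<close>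
  (\<open>expected_sqnorm_step\<close>). Since \<open>\<parallel>f\<parallel>\<close> may exceed \<open>\<parallel>g\<parallel>\<close> by any factor,
  contraction alone does not suffice, and the component of \<open>f\<close> in \<open>V\<close> has to be removed exactly
  first. This is done by \<open>k\<close> steps of size \<open>1\<close>, where after each one \<open>K\<close> is replaced by the kernel of
  the functions in its range that vanish at \<open>x\<close>. Afterwards the kernel is zero, the component has
  disappeared, and the mean squared error is \<open>\<parallel>g\<parallel>\<^sup>2\<close> times the telescoping product of the factors
  \<open>1 + 1 / j\<close> for \<open>j \<le> k\<close>, that is \<open>k + 1\<close> (\<open>expected_deflation\<close>). Kaczmarz steps with decreasing \<open>a\<close> then
  lower the factor \<open>1 + u\<close> from \<open>u = k\<close> to \<open>u \<le> 1\<close> in about \<open>2 k ln k\<close> steps, and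
  further to \<open>u \<le> 4 k / n\<close> with the at least \<open>n / 2\<close> steps that remain (\<open>excess_bound\<close>).
  The hypothesis on \<open>m\<close> enters through \<open>48 \<surd>2 k ln (2 n) \<le> n\<close>. So the mean squared
  error is at most \<open>(1 + 4 m / n) \<parallel>g\<parallel>\<^sup>2\<close>, and the stated bound exceeds this by the
  factor \<open>1 / (1 - \<delta>) \<ge> 1\<close>.
\<close>

section \<open>Square-integrable functions\<close>

lemma L2_measurable: "f \<in> L2 \<mu> \<Longrightarrow> f \<in> borel_measurable \<mu>"
  by (simp add: L2_def)

lemma L2_integrable_mult:
  assumes "f \<in> L2 \<mu>" "g \<in> L2 \<mu>"
  shows "integrable \<mu> (\<lambda>x. f x * g x)"
proof (rule Bochner_Integration.integrable_bound)
  show "integrable \<mu> (\<lambda>x. (f x)\<^sup>2 + (g x)\<^sup>2)"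
    using assms by (simp add: L2_def)
  show "(\<lambda>x. f x * g x) \<in> borel_measurable \<mu>"
    using assms by (auto simp: L2_def)
  have "norm (f x * g x) \<le> norm ((f x)\<^sup>2 + (g x)\<^sup>2)" for x
  proof -
    have "0 \<le> (\<bar>f x\<bar> - \<bar>g x\<bar>)\<^sup>2" "0 \<le> \<bar>f x\<bar> * \<bar>g x\<bar>" by auto
    then have "\<bar>f x\<bar> * \<bar>g x\<bar> \<le> (f x)\<^sup>2 + (g x)\<^sup>2" unfolding power2_diff power2_abs by linarith
    then show ?thesis by (simp add: abs_mult)
  qed
  then show "AE x in \<mu>. norm (f x * g x) \<le> norm ((f x)\<^sup>2 + (g x)\<^sup>2)" by simp
qed

lemma L2_integrable_square: "f \<in> L2 \<mu> \<Longrightarrow> integrable \<mu> (\<lambda>x. (f x)\<^sup>2)"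
  by (simp add: L2_def)

lemma L2_zero [simp]: "(\<lambda>_. 0) \<in> L2 \<mu>"
  by (simp add: L2_def)

lemma L2_cmult: "f \<in> L2 \<mu> \<Longrightarrow> (\<lambda>x. c * f x) \<in> L2 \<mu>"
  by (auto simp: L2_def power_mult_distrib)

lemma L2_add:
  assumes "f \<in> L2 \<mu>" "g \<in> L2 \<mu>"
  shows "(\<lambda>x. f x + g x) \<in> L2 \<mu>"
  using assms L2_integrable_mult[OF assms]
  by (auto simp: L2_def power2_sum mult.assoc)

lemma L2_diff:
  assumes "f \<in> L2 \<mu>" "g \<in> L2 \<mu>"
  shows "(\<lambda>x. f x - g x) \<in> L2 \<mu>"
  using L2_add[OF assms(1) L2_cmult[OF assms(2), of "-1"]] by simp

lemma L2_sum: "(\<And>i. i \<in> I \<Longrightarrow> f i \<in> L2 \<mu>) \<Longrightarrow> (\<lambda>x. \<Sum>i\<in>I. f i x) \<in> L2 \<mu>"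
  by (induction I rule: infinite_finite_induct) (auto intro!: L2_add)

lemma L2_dist_power2: "(L2_dist \<mu> f g)\<^sup>2 = (\<integral>x. (f x - g x)\<^sup>2 \<partial>\<mu>)"
  by (simp add: L2_dist_def)

lemma L2_integral_diff_le:
  assumes "f \<in> L2 \<mu>" "g \<in> L2 \<mu>" "h \<in> L2 \<mu>"
  shows "(\<integral>x. (f x - g x)\<^sup>2 \<partial>\<mu>) \<le> 2 * (L2_dist \<mu> f h)\<^sup>2 + 2 * (L2_dist \<mu> g h)\<^sup>2"
proof -
  note int = L2_integrable_square[OF L2_diff[OF assms(1,2)]]
    L2_integrable_square[OF L2_diff[OF assms(1,3)]]
    L2_integrable_square[OF L2_diff[OF assms(2,3)]]
  have "(f x - g x)\<^sup>2 \<le> 2 * (f x - h x)\<^sup>2 + 2 * (g x - h x)\<^sup>2" for x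
  proof -
    have "0 \<le> ((f x - h x) + (g x - h x))\<^sup>2" by simp
    then show ?thesis by (simp add: power2_eq_square algebra_simps)
  qed
  then have "(\<integral>x. (f x - g x)\<^sup>2 \<partial>\<mu>) \<le> (\<integral>x. 2 * (f x - h x)\<^sup>2 + 2 * (g x - h x)\<^sup>2 \<partial>\<mu>)"
    using int by (intro integral_mono) auto
  then show ?thesis using int by (simp add: L2_dist_power2)
qed


section \<open>Singular vectors of a compact operator\<close>

text \<open>
  The form to have in mind is \<open>B f g = \<langle>T f, T g\<rangle>\<close> for a compact operator \<open>T\<close> into another
  Hilbert space. Only this form on the source space is used: the target \<open>L2\<close> is not a type of
  class \<open>real_inner\<close>, because its elements are functions up to null sets.
\<close>

locale compact_form =
  fixes B :: "'f::{real_inner, complete_space} \<Rightarrow> 'f \<Rightarrow> real"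
  assumes B_add: "B (f + g) h = B f h + B g h"
    and B_scale: "B (c *\<^sub>R f) h = c * B f h"
    and B_sym: "B f g = B g f"
    and B_nonneg: "0 \<le> B f f"
    and B_compact: "bounded (range (u :: nat \<Rightarrow> 'f)) \<Longrightarrow>
      \<exists>r :: nat \<Rightarrow> nat. strict_mono r \<and> (\<forall>\<epsilon>>0. \<exists>N. \<forall>i\<ge>N. \<forall>j\<ge>N. B (u (r i) - u (r j)) (u (r i) - u (r j)) < \<epsilon>)"
begin

lemma B_add_right: "B h (f + g) = B h f + B h g"
  by (metis B_add B_sym)

lemma B_scale_right: "B h (c *\<^sub>R f) = c * B h f"
  by (metis B_scale B_sym)

lemma B_minus: "B (- f) h = - B f h"
  using B_scale[of "-1" f h] by simp

lemma B_diff: "B (f - g) h = B f h - B g h"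
  using B_add[of f "-g" h] by (simp add: B_minus)

lemma B_diff_right: "B h (f - g) = B h f - B h g"
  by (metis B_diff B_sym)

lemma B_zero [simp]: "B 0 h = 0" "B h 0 = 0"
  using B_scale[of 0 0 h] B_scale_right[of h 0 0] by simp_all

lemma B_sum: "B (\<Sum>i\<in>I. f i) h = (\<Sum>i\<in>I. B (f i) h)"
  by (induction I rule: infinite_finite_induct) (auto simp: B_add)

lemma B_sum_right: "B h (\<Sum>i\<in>I. f i) = (\<Sum>i\<in>I. B h (f i))"
  by (induction I rule: infinite_finite_induct) (auto simp: B_add_right)

lemmas B_algebra = B_add B_add_right B_diff B_diff_right B_scale B_scale_right

lemma B_split_le: "B f f \<le> 2 * B g g + 2 * B (f - g) (f - g)"
  using B_nonneg[of "f - 2 *\<^sub>R g"] by (simp add: B_algebra B_sym[of g f])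

text \<open>Otherwise a sequence in the unit ball along which \<open>B\<close> explodes would have a subsequence
  that is Cauchy for \<open>B\<close>, hence bounded for \<open>B\<close>.\<close>

lemma B_bounded: "\<exists>C\<ge>0. \<forall>f. B f f \<le> C * (norm f)\<^sup>2"
proof -
  have "\<exists>C. \<forall>f. norm f \<le> 1 \<longrightarrow> B f f \<le> C"
  proof (rule ccontr)
    assume "\<nexists>C. \<forall>f. norm f \<le> 1 \<longrightarrow> B f f \<le> C"
    then have "\<forall>i::nat. \<exists>f. norm f \<le> 1 \<and> B f f > real i" by (meson not_le)
    then obtain u where u: "\<And>i::nat. norm (u i) \<le> 1" "\<And>i. B (u i) (u i) > real i" by metis
    have bu: "bounded (range u)" using u(1) by (auto simp: bounded_iff)
    obtain r :: "nat \<Rightarrow> nat" where r: "strict_mono r"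
      "\<forall>\<epsilon>>0. \<exists>N. \<forall>i\<ge>N. \<forall>j\<ge>N. B (u (r i) - u (r j)) (u (r i) - u (r j)) < \<epsilon>"
      using B_compact[OF bu] by (elim exE conjE) (rule that, assumption+)
    obtain N where N: "\<And>i j. i \<ge> N \<Longrightarrow> j \<ge> N \<Longrightarrow> B (u (r i) - u (r j)) (u (r i) - u (r j)) < 1"
      using r(2)[rule_format, OF zero_less_one] by blast
    have bd: "B (u (r i)) (u (r i)) < 2 * B (u (r N)) (u (r N)) + 2" if "i \<ge> N" for i
      using B_split_le[of "u (r i)" "u (r N)"] N[OF that order.refl] by simp
    obtain i :: nat where i: "real i > 2 * B (u (r N)) (u (r N)) + 2" using reals_Archimedean2 by blast
    have "real (max i N) < B (u (r (max i N))) (u (r (max i N)))"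
      using u(2)[of "r (max i N)"] seq_suble[OF r(1), of "max i N"]
      by linarith
    moreover have "real i \<le> real (max i N)" by simp
    ultimately show False using bd[OF max.cobounded2[of N i]] i by linarith
  qed
  then obtain C where C: "\<And>f. norm f \<le> 1 \<Longrightarrow> B f f \<le> C" by blast
  have "B f f \<le> C * (norm f)\<^sup>2" for f
  proof (cases "f = 0")
    case False
    have "B ((1 / norm f) *\<^sub>R f) ((1 / norm f) *\<^sub>R f) \<le> C" using False by (intro C) simp
    then show ?thesis using False by (simp add: B_algebra power2_eq_square field_simps)
  qed simp
  moreover have "C \<ge> 0" using C[of 0] by simp
  ultimately show ?thesis by blast
qed

lemma B_continuous:
  assumes "u \<longlonglongrightarrow> f"
  shows "(\<lambda>i. B (u i) (u i)) \<longlonglongrightarrow> B f f"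
proof -
  obtain C where C: "C \<ge> 0" "\<And>f. B f f \<le> C * (norm f)\<^sup>2" using B_bounded by blast
  have d: "(\<lambda>i. norm (u i - f)) \<longlonglongrightarrow> 0"
    using assms by (simp add: LIM_zero tendsto_norm_zero)
  have q: "(\<lambda>i. B (u i - f) (u i - f)) \<longlonglongrightarrow> 0"
  proof (rule tendsto_sandwich[OF _ _ tendsto_const])
    show "(\<lambda>i. C * (norm (u i - f))\<^sup>2) \<longlonglongrightarrow> 0"
      using tendsto_mult[OF tendsto_const[of C] tendsto_power[OF d, of 2]] by simp
  qed (use C B_nonneg in auto)
  have cs: "\<bar>B g h\<bar> \<le> sqrt (B g g) * sqrt (B h h)" for g h
  proof -
    have pos: "0 \<le> B g g - 2 * s * B g h + s\<^sup>2 * B h h" for s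
      using B_nonneg[of "g - s *\<^sub>R h"]
      by (simp add: B_algebra B_sym[of h g] power2_eq_square algebra_simps)
    have "(B g h)\<^sup>2 \<le> B g g * B h h"
    proof (cases "B h h = 0")
      case True
      have "B g h = 0"
      proof (rule ccontr)
        assume "B g h \<noteq> 0"
        then show False using pos[of "(B g g + 1) / (2 * B g h)"] True B_nonneg[of g] by simp
      qed
      then show ?thesis using True by simp
    next
      case False
      then have "B h h > 0" using B_nonneg[of h] by simp
      then show ?thesis using pos[of "B g h / B h h"] by (simp add: power2_eq_square field_simps)
    qed
    then show ?thesis
      by (metis real_sqrt_abs real_sqrt_le_iff real_sqrt_mult)
  qed
  have c: "(\<lambda>i. B f (u i - f)) \<longlonglongrightarrow> 0"
  proof (rule tendsto_rabs_zero_cancel, rule tendsto_sandwich[OF _ _ tendsto_const])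
    show "(\<lambda>i. sqrt (B f f) * sqrt (B (u i - f) (u i - f))) \<longlonglongrightarrow> 0"
      using tendsto_mult[OF tendsto_const tendsto_real_sqrt[OF q]] by simp
  qed (use cs in auto)
  have "B (u i) (u i) = B f f + 2 * B f (u i - f) + B (u i - f) (u i - f)" for i
    by (simp add: B_algebra B_sym[of f "u i"])
  then show ?thesis
    using tendsto_add[OF tendsto_add[OF tendsto_const[of "B f f"] tendsto_mult[OF tendsto_const[of 2] c]] q]
    by simp
qed

text \<open>A maximising sequence has a subsequence that is Cauchy for \<open>B\<close>; the parallelogram laws
  for \<open>B\<close> and for the norm then force it to be Cauchy in norm, and its limit is a maximiser.\<close>

lemma maximiser_exists:
  assumes W: "subspace W" "closed W"
  shows "\<exists>v\<in>W. (norm v = 1 \<and> B v v > 0 \<or> v = 0) \<and> (\<forall>f\<in>W. B f f \<le> B v v * (norm f)\<^sup>2)"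
proof -
  obtain C where C: "C \<ge> 0" "\<And>f. B f f \<le> C * (norm f)\<^sup>2" using B_bounded by blast
  define S where "S = (\<lambda>f. B f f) ` {f \<in> W. norm f \<le> 1}"
  define s where "s = Sup S"
  have bdd: "bdd_above S"
    unfolding S_def bdd_above_def
  proof (intro exI ballI)
    fix x assume "x \<in> (\<lambda>f. B f f) ` {f \<in> W. norm f \<le> 1}"
    then obtain f where f: "x = B f f" "norm f \<le> 1" by auto
    then have "(norm f)\<^sup>2 \<le> 1" by (simp add: power_le_one)
    then have "C * (norm f)\<^sup>2 \<le> C" using C(1) mult_left_le by blast
    then show "x \<le> C" using C(2)[of f] f by simp
  qed
  have ne: "0 \<in> S" using W(1) by (auto simp: S_def subspace_0 intro!: image_eqI[where x=0])
  have le_s: "B f f \<le> s * (norm f)\<^sup>2" if "f \<in> W" for f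
  proof (cases "f = 0")
    case False
    have "B ((1 / norm f) *\<^sub>R f) ((1 / norm f) *\<^sub>R f) \<in> S"
      unfolding S_def using False that W(1) by (intro imageI) (simp add: subspace_scale)
    then have "B ((1 / norm f) *\<^sub>R f) ((1 / norm f) *\<^sub>R f) \<le> s"
      unfolding s_def using bdd by (rule cSup_upper)
    then show ?thesis using False by (simp add: B_algebra power2_eq_square field_simps)
  qed simp
  have s0: "s \<ge> 0" unfolding s_def using ne bdd by (rule cSup_upper)
  show ?thesis
  proof (cases "s = 0")
    case True
    then show ?thesis using le_s W(1) by (intro bexI[of _ 0]) (auto simp: subspace_0)
  next
    case False
    then have s: "s > 0" using s0 by simp
    have "\<exists>f\<in>W. norm f \<le> 1 \<and> B f f > s - 1 / real (Suc i)" for i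
    proof -
      have "s - 1 / real (Suc i) < Sup S" unfolding s_def by simp
      then obtain x where "x \<in> S" "s - 1 / real (Suc i) < x"
        using less_cSup_iff[OF _ bdd] ne by blast
      then show ?thesis by (auto simp: S_def)
    qed
    then obtain u where u: "\<And>i. u i \<in> W" "\<And>i. norm (u i) \<le> 1" "\<And>i. B (u i) (u i) > s - 1 / real (Suc i)"
      by metis
    have bu: "bounded (range u)" using u(2) by (auto simp: bounded_iff)
    obtain r :: "nat \<Rightarrow> nat" where r: "strict_mono r"
      "\<forall>\<epsilon>>0. \<exists>N. \<forall>i\<ge>N. \<forall>j\<ge>N. B (u (r i) - u (r j)) (u (r i) - u (r j)) < \<epsilon>"
      using B_compact[OF bu] by (elim exE conjE) (rule that, assumption+)
    define w where "w = u \<circ> r"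
    have w: "w i \<in> W" "norm (w i) \<le> 1" "B (w i) (w i) > s - 1 / real (Suc i)" for i
    proof -
      show "w i \<in> W" "norm (w i) \<le> 1" using u by (auto simp: w_def)
      have "1 / real (Suc (r i)) \<le> 1 / real (Suc i)"
        using seq_suble[OF r(1), of i] by (intro divide_left_mono) auto
      then show "B (w i) (w i) > s - 1 / real (Suc i)" using u(3)[of "r i"] by (simp add: w_def)
    qed
    have dist: "s * (norm (w i - w j))\<^sup>2 \<le>
        2 / real (Suc i) + 2 / real (Suc j) + B (w i - w j) (w i - w j)" for i j
    proof -
      have par: "(norm (w i + w j))\<^sup>2 = 2 * (norm (w i))\<^sup>2 + 2 * (norm (w j))\<^sup>2 - (norm (w i - w j))\<^sup>2"
        by (simp add: power2_norm_eq_inner inner_add_left inner_add_right inner_diff_left inner_diff_right)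
      have "(norm (w i))\<^sup>2 \<le> 1" "(norm (w j))\<^sup>2 \<le> 1" using w(2) by (simp_all add: power_le_one)
      then have "(norm (w i + w j))\<^sup>2 \<le> 4 - (norm (w i - w j))\<^sup>2" using par by simp
      then have "s * (norm (w i + w j))\<^sup>2 \<le> s * (4 - (norm (w i - w j))\<^sup>2)" using s by simp
      moreover have "B (w i + w j) (w i + w j) \<le> s * (norm (w i + w j))\<^sup>2"
        using w(1) W(1) by (intro le_s) (simp add: subspace_add)
      moreover have "B (w i + w j) (w i + w j) =
          2 * B (w i) (w i) + 2 * B (w j) (w j) - B (w i - w j) (w i - w j)"
        by (simp add: B_algebra)
      ultimately show ?thesis using w(3)[of i] w(3)[of j] by (simp add: algebra_simps)
    qed
    have "Cauchy w"
    proof (rule CauchyI)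
      fix e :: real assume e: "e > 0"
      define d where "d = s * e\<^sup>2 / 5"
      have d: "d > 0" using s e by (simp add: d_def)
      obtain N1 where N1: "\<And>i j. i \<ge> N1 \<Longrightarrow> j \<ge> N1 \<Longrightarrow> B (w i - w j) (w i - w j) < d"
        using r(2)[rule_format, OF d] unfolding w_def comp_def by blast
      obtain N2 :: nat where N2: "1 / d < real N2" using reals_Archimedean2 by blast
      have small: "1 / real (Suc i) < d" if "i \<ge> N2" for i
      proof -
        have "1 / d < real (Suc i)" using N2 that by linarith
        then show ?thesis using d by (simp add: field_simps)
      qed
      show "\<exists>M. \<forall>i\<ge>M. \<forall>j\<ge>M. norm (w i - w j) < e"
      proof (intro exI allI impI)
        fix i j assume "i \<ge> max N1 N2" "j \<ge> max N1 N2"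
        then have "s * (norm (w i - w j))\<^sup>2 < 5 * d"
          using dist[of i j] small[of i] small[of j] N1[of i j] by simp
        then have "(norm (w i - w j))\<^sup>2 < e\<^sup>2" using s by (simp add: d_def)
        then show "norm (w i - w j) < e" using e by (simp add: power_less_imp_less_base)
      qed
    qed
    then obtain v where v: "w \<longlonglongrightarrow> v" using Cauchy_convergent_iff convergent_def by blast
    have vW: "v \<in> W" using W(2) v w(1) closed_sequentially by blast
    have v1: "norm v \<le> 1"
      by (rule LIMSEQ_le_const2[OF tendsto_norm[OF v]]) (use w(2) in auto)
    have "s \<le> B v v"
    proof (rule LIMSEQ_le[OF _ B_continuous[OF v]])
      show "(\<lambda>i. s - 1 / real (Suc i)) \<longlonglongrightarrow> s"
        using tendsto_diff[OF tendsto_const[of s] LIMSEQ_inverse_real_of_nat]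
        by (simp add: inverse_eq_divide)
      show "\<exists>N. \<forall>i\<ge>N. s - 1 / real (Suc i) \<le> B (w i) (w i)"
        using w(3) less_imp_le by blast
    qed
    moreover have "B v v \<le> s * (norm v)\<^sup>2" by (rule le_s[OF vW])
    ultimately have "s * 1 \<le> s * (norm v)\<^sup>2" by simp
    then have "1 \<le> (norm v)\<^sup>2" using s by (simp only: mult_le_cancel_left_pos)
    then have "norm v = 1" using v1 using power2_le_imp_le[of 1 "norm v"] by simp
    with \<open>s \<le> B v v\<close> \<open>B v v \<le> s * (norm v)\<^sup>2\<close> have "B v v = s" by simp
    then show ?thesis using vW \<open>norm v = 1\<close> s le_s by (intro bexI[of _ v]) auto
  qed
qed

text \<open>The first-order condition at a maximiser, by perturbing \<open>v\<close> in the direction \<open>f\<close>. It makes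
  singular vectors orthogonal for both inner products.\<close>

lemma maximiser_orthogonal:
  assumes W: "subspace W" and v: "v \<in> W" "norm v = 1" "\<And>f. f \<in> W \<Longrightarrow> B f f \<le> B v v * (norm f)\<^sup>2"
    and f: "f \<in> W" "inner v f = 0"
  shows "B v f = 0"
proof -
  define c where "c = B v v * (norm f)\<^sup>2 - B f f"
  have c: "2 * t * B v f \<le> t\<^sup>2 * c" for t
  proof -
    have "v + t *\<^sub>R f \<in> W" using W v(1) f(1) by (simp add: subspace_add subspace_scale)
    then have le: "B (v + t *\<^sub>R f) (v + t *\<^sub>R f) \<le> B v v * (norm (v + t *\<^sub>R f))\<^sup>2" by (rule v(3))
    have "(norm v)\<^sup>2 = 1" using v(2) by simp
    then have "inner v v = 1" by (simp add: power2_norm_eq_inner)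
    then have "(norm (v + t *\<^sub>R f))\<^sup>2 = 1 + t\<^sup>2 * (norm f)\<^sup>2"
      using f(2) unfolding power2_norm_eq_inner
      by (simp add: inner_add_left inner_add_right inner_commute[of f v] power2_eq_square)
    with le show ?thesis
      by (simp add: B_algebra B_sym[of f v] c_def power2_eq_square algebra_simps)
  qed
  have c0: "c \<ge> 0" using v(3)[OF f(1)] by (simp add: c_def)
  show ?thesis
  proof (rule ccontr)
    assume ne: "B v f \<noteq> 0"
    define t where "t = B v f / (c + 1)"
    have "2 * (B v f)\<^sup>2 * (c + 1) / (c + 1)\<^sup>2 \<le> (B v f)\<^sup>2 * c / (c + 1)\<^sup>2"
      using c[of t] c0 by (simp add: t_def power2_eq_square)
    then have "2 * (B v f)\<^sup>2 * (c + 1) \<le> (B v f)\<^sup>2 * c"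
      using c0 by (subst (asm) divide_le_cancel) auto
    then have "(B v f)\<^sup>2 * (c + 2) \<le> 0" unfolding distrib_left by linarith
    moreover have "(B v f)\<^sup>2 * (c + 2) > 0" using ne c0 by simp
    ultimately show False by simp
  qed
qed

definition complement :: "(nat \<Rightarrow> 'f) \<Rightarrow> nat \<Rightarrow> 'f set" where
  "complement v k = {f. \<forall>i<k. inner (v i) f = 0}"

lemma complement_subspace: "subspace (complement v k)"
  by (auto simp: complement_def subspace_def inner_add_right)

lemma complement_closed: "closed (complement v k)"
proof -
  have "complement v k = (\<Inter>i\<in>{..<k}. {f. inner (v i) f = 0})" by (auto simp: complement_def)
  then show ?thesis by (auto intro!: closed_INT closed_Collect_eq continuous_intros)
qed

text \<open>Singular vectors in decreasing order of singular values. Once \<open>B\<close> vanishes on the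
  orthogonal complement of the vectors found so far, the remaining ones are \<open>0\<close>; this lets the
  sequence be total also when the space has finite dimension.\<close>

definition singular_system :: "(nat \<Rightarrow> 'f) \<Rightarrow> bool" where
  "singular_system v \<longleftrightarrow> (\<forall>k. v k \<in> complement v k \<and>
     (norm (v k) = 1 \<and> B (v k) (v k) > 0 \<or> v k = 0) \<and>
     (\<forall>f\<in>complement v k. B f f \<le> B (v k) (v k) * (norm f)\<^sup>2))"

lemma singular_system_exists: "\<exists>v. singular_system v"
proof -
  have "\<exists>v. \<forall>k. (v k \<in> complement v k \<and>
     (norm (v k) = 1 \<and> B (v k) (v k) > 0 \<or> v k = 0) \<and>
     (\<forall>f\<in>complement v k. B f f \<le> B (v k) (v k) * (norm f)\<^sup>2))"
  proof (rule dependent_wf_choice[OF wf_less])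
    fix P v w and k :: nat and x
    show "(x \<in> complement v k \<and> (norm x = 1 \<and> B x x > 0 \<or> x = 0) \<and>
        (\<forall>f\<in>complement v k. B f f \<le> B x x * (norm f)\<^sup>2)) \<longleftrightarrow>
      (x \<in> complement w k \<and> (norm x = 1 \<and> B x x > 0 \<or> x = 0) \<and>
        (\<forall>f\<in>complement w k. B f f \<le> B x x * (norm f)\<^sup>2))"
      if "\<And>i. (i, k) \<in> {(x, y). x < y} \<Longrightarrow> v i = w i"
    proof -
      have "complement v k = complement w k" using that by (auto simp: complement_def)
      then show ?thesis by simp
    qed
  next
    fix k :: nat and v
    show "\<exists>x. x \<in> complement v k \<and> (norm x = 1 \<and> B x x > 0 \<or> x = 0) \<and>
        (\<forall>f\<in>complement v k. B f f \<le> B x x * (norm f)\<^sup>2)"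
      using maximiser_exists[OF complement_subspace complement_closed] by blast
  qed
  then show ?thesis by (simp add: singular_system_def)
qed

lemma singular_systemD:
  assumes "singular_system v"
  shows "v k \<in> complement v k" "norm (v k) = 1 \<and> B (v k) (v k) > 0 \<or> v k = 0"
    "f \<in> complement v k \<Longrightarrow> B f f \<le> B (v k) (v k) * (norm f)\<^sup>2"
  using assms by (auto simp: singular_system_def)

lemma complement_antimono: "i \<le> k \<Longrightarrow> complement v k \<subseteq> complement v i"
  by (auto simp: complement_def)

lemma singular_inner:
  assumes "singular_system v"
  shows "i \<noteq> j \<Longrightarrow> inner (v i) (v j) = 0"
proof (induction i j rule: linorder_less_wlog)
  case (less i j)
  then show ?case using singular_systemD(1)[OF assms, of j] by (simp add: complement_def)
next
  case (sym i j)
  then show ?case by (metis inner_commute)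
qed simp

lemma singular_B_complement:
  assumes v: "singular_system v" and f: "f \<in> complement v k" and i: "i < k"
  shows "B (v i) f = 0"
proof (cases "v i = 0")
  case False
  then have "norm (v i) = 1" using singular_systemD(2)[OF v, of i] by simp
  moreover have "f \<in> complement v i" using f i complement_antimono[of i k v] by auto
  moreover have "inner (v i) f = 0" using f i by (simp add: complement_def)
  ultimately show ?thesis
    using maximiser_orthogonal[OF complement_subspace singular_systemD(1)[OF v]]
      singular_systemD(3)[OF v] by blast
qed simp

lemma singular_B:
  assumes v: "singular_system v"
  shows "i \<noteq> j \<Longrightarrow> B (v i) (v j) = 0"
proof (induction i j rule: linorder_less_wlog)
  case (less i j)
  then show ?case using singular_B_complement[OF v singular_systemD(1)[OF v]] by blast
next
  case (sym i j)
  then show ?case by (metis B_sym)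
qed simp

lemma singular_value_antimono:
  assumes v: "singular_system v" and "i \<le> k"
  shows "B (v k) (v k) \<le> B (v i) (v i)"
proof -
  have "v k \<in> complement v i" using singular_systemD(1)[OF v, of k] complement_antimono[OF assms(2), of v] by blast
  then have "B (v k) (v k) \<le> B (v i) (v i) * (norm (v k))\<^sup>2" by (rule singular_systemD(3)[OF v])
  also have "\<dots> \<le> B (v i) (v i)"
    using singular_systemD(2)[OF v, of k] B_nonneg[of "v i"] by auto
  finally show ?thesis .
qed

text \<open>The remainder lies in the complement, where the form is controlled by the next singular value,
  and is orthogonal to what was removed, so that its norm is at most that of \<open>f\<close>.\<close>

lemma singular_remainder:
  fixes v f k
  assumes v: "singular_system v"
  defines "h \<equiv> f - (\<Sum>i<k. inner (v i) f *\<^sub>R v i)"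
  shows "h \<in> complement v k" "B h h \<le> B (v k) (v k) * (norm f)\<^sup>2"
proof -
  have co: "inner (v j) (\<Sum>i<k. inner (v i) f *\<^sub>R v i) = inner (v j) f" if "j < k" for j
  proof -
    have "inner (v j) (\<Sum>i<k. inner (v i) f *\<^sub>R v i) = (\<Sum>i<k. inner (v i) f * inner (v j) (v i))"
      by (simp add: inner_sum_right)
    also have "\<dots> = (\<Sum>i<k. if i = j then inner (v j) f * inner (v j) (v j) else 0)"
      by (intro sum.cong) (auto simp: singular_inner[OF v])
    also have "\<dots> = inner (v j) f * inner (v j) (v j)" using that by simp
    also have "\<dots> = inner (v j) f"
      using singular_systemD(2)[OF v, of j] by (auto simp: power2_norm_eq_inner[symmetric])
    finally show ?thesis .
  qed
  show h: "h \<in> complement v k" by (auto simp: complement_def h_def inner_diff_right co)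
  have "inner (\<Sum>i<k. inner (v i) f *\<^sub>R v i) h = 0"
    using h by (simp add: inner_sum_left complement_def)
  then have "(norm f)\<^sup>2 = (norm h)\<^sup>2 + (norm (\<Sum>i<k. inner (v i) f *\<^sub>R v i))\<^sup>2"
    by (simp add: power2_norm_eq_inner h_def inner_diff_left inner_diff_right inner_commute)
  then have "(norm h)\<^sup>2 \<le> (norm f)\<^sup>2" by simp
  then have "B (v k) (v k) * (norm h)\<^sup>2 \<le> B (v k) (v k) * (norm f)\<^sup>2"
    by (intro mult_left_mono B_nonneg)
  then show "B h h \<le> B (v k) (v k) * (norm f)\<^sup>2" using singular_systemD(3)[OF v h] by simp
qed

end

text \<open>Gaussian elimination on the last equation.\<close>

lemma homogeneous_system_nontrivial:
  fixes a :: "nat \<Rightarrow> nat \<Rightarrow> real"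
  shows "\<exists>c. (\<exists>i\<le>m. c i \<noteq> 0) \<and> (\<forall>j<m. (\<Sum>i\<le>m. c i * a j i) = 0)"
proof (induction m arbitrary: a)
  case 0
  then show ?case by (intro exI[of _ "\<lambda>_. 1"]) simp
next
  case (Suc m)
  show ?case
  proof (cases "\<forall>j<Suc m. a j (Suc m) = 0")
    case True
    then show ?thesis
      by (intro exI[of _ "\<lambda>i. if i = Suc m then 1 else 0"]) (auto simp: if_distrib if_distribR cong: if_cong)
  next
    case False
    then obtain p where p: "p < Suc m" "a p (Suc m) \<noteq> 0" by blast
    define b where "b j i = a j i - a j (Suc m) / a p (Suc m) * a p i" for j i
    \<comment> \<open>enumerates the equations other than \<open>p\<close>\<close>
    define \<pi> where "\<pi> j = (if j < p then j else Suc j)" for j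
    obtain c where c: "\<exists>i\<le>m. c i \<noteq> 0" "\<forall>j<m. (\<Sum>i\<le>m. c i * b (\<pi> j) i) = 0"
      using Suc[of "\<lambda>j. b (\<pi> j)"] by blast
    \<comment> \<open>the last unknown is chosen to satisfy equation \<open>p\<close>, the pivot\<close>
    define c' where "c' i = (if i = Suc m then - (\<Sum>i\<le>m. c i * a p i) / a p (Suc m) else c i)" for i
    have s: "(\<Sum>i\<le>Suc m. c' i * a j i) = (\<Sum>i\<le>m. c i * b j i)" for j
    proof -
      have "(\<Sum>i\<le>Suc m. c' i * a j i) =
          (\<Sum>i\<le>m. c i * a j i) - (\<Sum>i\<le>m. c i * a p i) / a p (Suc m) * a j (Suc m)"
        by (simp add: c'_def)
      also have "\<dots> = (\<Sum>i\<le>m. c i * b j i)"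
        by (simp add: b_def right_diff_distrib sum_subtractf sum_distrib_left sum_distrib_right
            sum_divide_distrib mult_ac)
      finally show ?thesis .
    qed
    have "(\<Sum>i\<le>Suc m. c' i * a j i) = 0" if j: "j < Suc m" for j
    proof (cases "j = p")
      case True
      then show ?thesis unfolding s using p(2) by (simp add: b_def)
    next
      case False
      then obtain j' where "j' < m" "j = \<pi> j'"
      proof (cases "j < p")
        case True
        then show ?thesis using that[of j] p(1) by (simp add: \<pi>_def)
      next
        case f: False
        then show ?thesis using that[of "j - 1"] False j by (simp add: \<pi>_def split: if_splits)
      qed
      then show ?thesis unfolding s using c(2) by simp
    qed
    moreover have "\<exists>i\<le>Suc m. c' i \<noteq> 0"
    proof -
      obtain i where "i \<le> m" "c i \<noteq> 0" using c(1) by blast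
      then show ?thesis by (intro exI[of _ i]) (simp add: c'_def)
    qed
    ultimately show ?thesis by blast
  qed
qed

section \<open>Compact embeddings and the worst case error\<close>

lemma compact_embeddingD:
  assumes "compact_embedding \<mu> APP"
  shows "APP f \<in> L2 \<mu>"
    and "AE x in \<mu>. APP (f + g) x = APP f x + APP g x"
    and "AE x in \<mu>. APP (c *\<^sub>R f) x = c * APP f x"
    and "AE x in \<mu>. APP (f - g) x = APP f x - APP g x"
proof -
  show "APP f \<in> L2 \<mu>" "AE x in \<mu>. APP (f + g) x = APP f x + APP g x"
    "AE x in \<mu>. APP (c *\<^sub>R f) x = c * APP f x" for f g c
    using assms by (auto simp: compact_embedding_def)
  from this(2)[of f "-1 *\<^sub>R g"] this(3)[of "-1" g]
  show "AE x in \<mu>. APP (f - g) x = APP f x - APP g x" by eventually_elim simp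
qed

lemma compact_embedding_sum:
  fixes k :: nat
  assumes "compact_embedding \<mu> APP"
  shows "AE x in \<mu>. APP (\<Sum>i<k. c i *\<^sub>R v i) x = (\<Sum>i<k. c i * APP (v i) x)"
proof (induction k)
  case 0
  from compact_embeddingD(3)[OF assms, of 0 0] show ?case by eventually_elim simp
next
  case (Suc k)
  from Suc compact_embeddingD(2)[OF assms, of "\<Sum>i<k. c i *\<^sub>R v i" "c k *\<^sub>R v k"]
    compact_embeddingD(3)[OF assms, of "c k" "v k"]
  show ?case by eventually_elim simp
qed

definition embedding_form ::
  "'a measure \<Rightarrow> ('f \<Rightarrow> 'a \<Rightarrow> real) \<Rightarrow> 'f \<Rightarrow> 'f \<Rightarrow> real" where
  "embedding_form \<mu> APP f g = (\<integral>x. APP f x * APP g x \<partial>\<mu>)"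

lemma embedding_form_compact_form:
  fixes APP :: "'f::{real_inner, complete_space} \<Rightarrow> 'a \<Rightarrow> real"
  assumes emb: "compact_embedding \<mu> APP"
  shows "compact_form (embedding_form \<mu> APP)"
proof
  note D = compact_embeddingD[OF emb]
  note [measurable] = D(1)[THEN L2_measurable]
  fix f g h c and u :: "nat \<Rightarrow> 'f"
  have "embedding_form \<mu> APP (f + g) h = (\<integral>x. APP f x * APP h x + APP g x * APP h x \<partial>\<mu>)"
    unfolding embedding_form_def
    proof (rule integral_cong_AE)
    show "AE x in \<mu>. APP (f + g) x * APP h x = APP f x * APP h x + APP g x * APP h x"
      using D(2)[of f g] by eventually_elim (simp add: algebra_simps power2_eq_square)
  qed measurable
  then show "embedding_form \<mu> APP (f + g) h = embedding_form \<mu> APP f h + embedding_form \<mu> APP g h"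
    by (simp add: embedding_form_def L2_integrable_mult D(1))
  have "embedding_form \<mu> APP (c *\<^sub>R f) h = (\<integral>x. c * (APP f x * APP h x) \<partial>\<mu>)"
    unfolding embedding_form_def
    proof (rule integral_cong_AE)
    show "AE x in \<mu>. APP (c *\<^sub>R f) x * APP h x = c * (APP f x * APP h x)"
      using D(3)[of c f] by eventually_elim (simp add: algebra_simps power2_eq_square)
  qed measurable
  then show "embedding_form \<mu> APP (c *\<^sub>R f) h = c * embedding_form \<mu> APP f h"
    by (simp add: embedding_form_def)
  show "embedding_form \<mu> APP f g = embedding_form \<mu> APP g f"
    by (simp add: embedding_form_def mult.commute)
  show "0 \<le> embedding_form \<mu> APP f f"
    by (simp add: embedding_form_def)
  assume bu: "bounded (range u)"
  have "\<exists>g\<in>L2 \<mu>. \<exists>r. strict_mono r \<and> (\<lambda>k. L2_dist \<mu> (APP (u (r k))) g) \<longlonglongrightarrow> 0"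
    using emb bu by (simp add: compact_embedding_def)
  then obtain g r where g: "g \<in> L2 \<mu>" and r: "strict_mono r"
    and lim: "(\<lambda>k. L2_dist \<mu> (APP (u (r k))) g) \<longlonglongrightarrow> 0"
    by blast
  have le: "embedding_form \<mu> APP (f - h) (f - h) \<le> 2 * (L2_dist \<mu> (APP f) g)\<^sup>2 + 2 * (L2_dist \<mu> (APP h) g)\<^sup>2" for f h
  proof -
    have "embedding_form \<mu> APP (f - h) (f - h) = (\<integral>x. (APP f x - APP h x)\<^sup>2 \<partial>\<mu>)"
      unfolding embedding_form_def
      proof (rule integral_cong_AE)
    show "AE x in \<mu>. APP (f - h) x * APP (f - h) x = (APP f x - APP h x)\<^sup>2"
      using D(4)[of f h] by eventually_elim (simp add: power2_eq_square)
  qed measurable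
    then show ?thesis using L2_integral_diff_le[OF D(1) D(1) g] by simp
  qed
  show "\<exists>r :: nat \<Rightarrow> nat. strict_mono r \<and> (\<forall>\<epsilon>>0. \<exists>N. \<forall>i\<ge>N. \<forall>j\<ge>N.
      embedding_form \<mu> APP (u (r i) - u (r j)) (u (r i) - u (r j)) < \<epsilon>)"
  proof (intro exI[of _ r] conjI allI impI)
    fix \<epsilon> :: real assume e: "\<epsilon> > 0"
    have lim2: "(\<lambda>k. (L2_dist \<mu> (APP (u (r k))) g)\<^sup>2) \<longlonglongrightarrow> 0"
      using tendsto_power[OF lim, of 2] by simp
    have "\<forall>\<^sub>F k in sequentially. (L2_dist \<mu> (APP (u (r k))) g)\<^sup>2 < \<epsilon> / 4"
      using e by (intro order_tendstoD(2)[OF lim2]) simp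
    then obtain N where N: "\<And>k. k \<ge> N \<Longrightarrow> (L2_dist \<mu> (APP (u (r k))) g)\<^sup>2 < \<epsilon> / 4"
      by (auto simp: eventually_sequentially)
    show "\<exists>N. \<forall>i\<ge>N. \<forall>j\<ge>N. embedding_form \<mu> APP (u (r i) - u (r j)) (u (r i) - u (r j)) < \<epsilon>"
    proof (intro exI[of _ N] allI impI)
      fix i j assume "i \<ge> N" "j \<ge> N"
      then show "embedding_form \<mu> APP (u (r i) - u (r j)) (u (r i) - u (r j)) < \<epsilon>"
        using N[of i] N[of j] le[of "u (r i)" "u (r j)"] by simp
    qed
  qed (rule r)
qed

text \<open>The functionals cannot tell \<open>w\<close> and \<open>-w\<close> in their common kernel apart, so one of the two is
  at least \<open>\<parallel>w\<parallel>\<close> away from the common output \<open>a\<close>, by the parallelogram law.\<close>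

lemma wor_error_ge_kernel:
  assumes emb: "compact_embedding \<mu> APP"
    and L: "\<And>j. j < m \<Longrightarrow> L j \<in> Lambda_all" and \<phi>: "\<phi> \<in> borel_vec m \<rightarrow>\<^sub>M L2_borel \<mu>"
    and w: "norm w \<le> 1" "\<And>j. j < m \<Longrightarrow> L j w = 0"
  shows "ennreal (sqrt (embedding_form \<mu> APP w w)) \<le> wor_error \<mu> APP (\<lambda>f. \<phi> (info L m f))"
proof -
  note D = compact_embeddingD[OF emb]
  note [measurable] = D(1)[THEN L2_measurable]
  define a where "a = \<phi> (\<lambda>j\<in>{..<m}. 0)"
  have "info L m w = (\<lambda>j\<in>{..<m}. 0)" "info L m (-w) = (\<lambda>j\<in>{..<m}. 0)"
    using L w(2) by (auto simp: info_def Lambda_all_def linear_neg intro!: ext)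
  then have out: "\<phi> (info L m w) = a" "\<phi> (info L m (-w)) = a" by (simp_all add: a_def)
  have "(\<lambda>j\<in>{..<m}. 0) \<in> space (borel_vec m)" by (simp add: space_PiM)
  then have "a \<in> space (L2_borel \<mu>)" unfolding a_def using \<phi> by (rule measurable_space[rotated])
  then have a: "a \<in> L2 \<mu>" by (simp add: L2_borel_def space_measure_of_conv)
  note [measurable] = L2_measurable[OF a]
  have dist_minus: "(L2_dist \<mu> (APP (-w)) a)\<^sup>2 = (\<integral>x. (APP w x + a x)\<^sup>2 \<partial>\<mu>)"
    unfolding L2_dist_power2
    proof (rule integral_cong_AE)
    show "AE x in \<mu>. (APP (-w) x - a x)\<^sup>2 = (APP w x + a x)\<^sup>2"
      using D(3)[of "-1" w] by eventually_elim (simp add: power2_eq_square algebra_simps)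
  qed measurable
  have "(L2_dist \<mu> (APP w) a)\<^sup>2 + (L2_dist \<mu> (APP (-w)) a)\<^sup>2 =
      (\<integral>x. (APP w x - a x)\<^sup>2 + (APP w x + a x)\<^sup>2 \<partial>\<mu>)"
    unfolding dist_minus L2_dist_power2[of _ "APP w"]
    by (intro Bochner_Integration.integral_add[symmetric] L2_integrable_square L2_diff L2_add D(1) a)
  also have "\<dots> \<ge> (\<integral>x. 2 * (APP w x * APP w x) \<partial>\<mu>)"
  proof (rule integral_mono)
    show "integrable \<mu> (\<lambda>x. 2 * (APP w x * APP w x))" by (intro integrable_mult_right L2_integrable_mult D(1))
    show "integrable \<mu> (\<lambda>x. (APP w x - a x)\<^sup>2 + (APP w x + a x)\<^sup>2)"
      by (intro Bochner_Integration.integrable_add L2_integrable_square L2_diff L2_add D(1) a)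
  qed (simp add: power2_eq_square algebra_simps)
  finally have "2 * embedding_form \<mu> APP w w \<le> (L2_dist \<mu> (APP w) a)\<^sup>2 + (L2_dist \<mu> (APP (-w)) a)\<^sup>2"
    by (simp add: embedding_form_def)
  then have "embedding_form \<mu> APP w w \<le> (L2_dist \<mu> (APP w) a)\<^sup>2 \<or>
      embedding_form \<mu> APP w w \<le> (L2_dist \<mu> (APP (-w)) a)\<^sup>2" by linarith
  then obtain f where f: "f = w \<or> f = -w" "embedding_form \<mu> APP w w \<le> (L2_dist \<mu> (APP f) a)\<^sup>2" by blast
  have "L2_dist \<mu> (APP f) a \<ge> 0" by (simp add: L2_dist_def)
  then have "sqrt (embedding_form \<mu> APP w w) \<le> L2_dist \<mu> (APP f) (\<phi> (info L m f))"
    using f out by (auto intro: real_le_lsqrt)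
  also have "ennreal \<dots> \<le> wor_error \<mu> APP (\<lambda>f. \<phi> (info L m f))"
    unfolding wor_error_def by (rule SUP_upper) (use f(1) w(1) in auto)
  finally show ?thesis by (simp add: ennreal_leI)
qed

text \<open>\<open>m\<close> functionals have a common zero in the span of the first \<open>m + 1\<close> singular vectors, where
  the form is at least the square of the smallest singular value involved.\<close>

lemma singular_value_le_e_wor:
  fixes APP :: "'f::{real_inner, complete_space} \<Rightarrow> 'a \<Rightarrow> real"
  assumes emb: "compact_embedding \<mu> APP"
    and v: "compact_form.singular_system (embedding_form \<mu> APP) v"
  shows "ennreal (sqrt (embedding_form \<mu> APP (v m) (v m))) \<le> e_wor \<mu> APP m Lambda_all"
  unfolding e_wor_def
proof (rule Inf_greatest, clarify)
  interpret compact_form "embedding_form \<mu> APP" by (rule embedding_form_compact_form[OF emb])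
  fix L :: "nat \<Rightarrow> 'f \<Rightarrow> real" and \<phi>
  assume L: "\<forall>j<m. L j \<in> Lambda_all" and \<phi>: "\<phi> \<in> borel_vec m \<rightarrow>\<^sub>M L2_borel \<mu>"
  show "ennreal (sqrt (embedding_form \<mu> APP (v m) (v m))) \<le> wor_error \<mu> APP (\<lambda>f. \<phi> (info L m f))"
  proof (cases "v m = 0")
    case False
    define s where "s = embedding_form \<mu> APP (v m) (v m)"
    have s: "s > 0" using singular_systemD(2)[OF v, of m] False by (simp add: s_def)
    have vi: "inner (v i) (v i) = 1" "embedding_form \<mu> APP (v i) (v i) \<ge> s" if "i \<le> m" for i
    proof -
      show *: "embedding_form \<mu> APP (v i) (v i) \<ge> s"
        unfolding s_def by (rule singular_value_antimono[OF v that])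
      then have "v i \<noteq> 0" using s by auto
      then show "inner (v i) (v i) = 1"
        using singular_systemD(2)[OF v, of i] by (simp add: power2_norm_eq_inner[symmetric])
    qed
    obtain c :: "nat \<Rightarrow> real" where c: "\<exists>i\<le>m. c i \<noteq> 0" "\<And>j. j < m \<Longrightarrow> (\<Sum>i\<le>m. c i * L j (v i)) = 0"
      using homogeneous_system_nontrivial[of m "\<lambda>j i. L j (v i)"] by blast
    define z where "z = (\<Sum>i\<le>m. c i *\<^sub>R v i)"
    define q where "q = (\<Sum>i\<le>m. (c i)\<^sup>2)"
    have q: "q > 0"
    proof -
      obtain i where "i \<le> m" "c i \<noteq> 0" using c(1) by blast
      then show ?thesis unfolding q_def by (intro sum_pos2[of _ i]) auto
    qed
    have "inner (v i) z = (\<Sum>j\<le>m. c j * inner (v i) (v j))" for i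
      by (simp add: z_def inner_sum_right)
    moreover have "inner z z = (\<Sum>i\<le>m. c i * inner (v i) z)"
      by (subst (1) z_def) (simp add: inner_sum_left)
    ultimately have "inner z z = (\<Sum>i\<le>m. \<Sum>j\<le>m. c i * (c j * inner (v i) (v j)))"
      by (simp add: sum_distrib_left)
    also have "\<dots> = (\<Sum>i\<le>m. \<Sum>j\<le>m. if j = i then (c i)\<^sup>2 else 0)"
      by (intro sum.cong refl) (auto simp: singular_inner[OF v] vi power2_eq_square)
    also have "\<dots> = q" by (simp add: q_def)
    finally have zz: "(norm z)\<^sup>2 = q" by (simp add: power2_norm_eq_inner)
    have "embedding_form \<mu> APP (v i) z = (\<Sum>j\<le>m. c j * embedding_form \<mu> APP (v i) (v j))" for i
      by (simp add: z_def B_sum_right B_scale_right)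
    moreover have "embedding_form \<mu> APP z z = (\<Sum>i\<le>m. c i * embedding_form \<mu> APP (v i) z)"
      by (subst (1) z_def) (simp add: B_sum B_scale)
    ultimately have "embedding_form \<mu> APP z z =
        (\<Sum>i\<le>m. \<Sum>j\<le>m. c i * (c j * embedding_form \<mu> APP (v i) (v j)))"
      by (simp add: sum_distrib_left)
    also have "\<dots> = (\<Sum>i\<le>m. \<Sum>j\<le>m. if j = i then (c i)\<^sup>2 * embedding_form \<mu> APP (v i) (v i) else 0)"
      by (intro sum.cong refl) (auto simp: singular_B[OF v] power2_eq_square)
    also have "\<dots> = (\<Sum>i\<le>m. (c i)\<^sup>2 * embedding_form \<mu> APP (v i) (v i))" by simp
    also have "\<dots> \<ge> (\<Sum>i\<le>m. (c i)\<^sup>2 * s)" by (intro sum_mono mult_left_mono vi) auto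
    finally have Bz: "embedding_form \<mu> APP z z \<ge> q * s" by (simp add: q_def sum_distrib_right)
    have nz: "norm z > 0" using zz q by auto
    define w where "w = (1 / norm z) *\<^sub>R z"
    have "L j w = 0" if "j < m" for j
    proof -
      have "linear (L j)" using L that by (simp add: Lambda_all_def)
      then have "L j w = (1 / norm z) * (\<Sum>i\<le>m. c i * L j (v i))"
        by (simp add: w_def z_def linear_cmul linear_sum sum_divide_distrib)
      then show ?thesis using c(2)[OF that] by simp
    qed
    moreover have "norm w \<le> 1" using nz by (simp add: w_def)
    ultimately have "ennreal (sqrt (embedding_form \<mu> APP w w)) \<le> wor_error \<mu> APP (\<lambda>f. \<phi> (info L m f))"
      using wor_error_ge_kernel[OF emb _ \<phi>, of L w] L by blast
    moreover have "s \<le> embedding_form \<mu> APP w w"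
    proof -
      have "embedding_form \<mu> APP w w = embedding_form \<mu> APP z z / q"
        using zz by (simp add: w_def B_algebra power2_eq_square)
      then show ?thesis using Bz q by (simp add: pos_le_divide_eq mult.commute)
    qed
    ultimately show ?thesis unfolding s_def[symmetric]
      by (meson ennreal_leI order.trans real_sqrt_le_mono)
  qed simp
qed

definition orthonormal :: "'a measure \<Rightarrow> nat \<Rightarrow> (nat \<Rightarrow> 'a \<Rightarrow> real) \<Rightarrow> bool" where
  "orthonormal \<mu> k \<eta> \<longleftrightarrow> (\<forall>i<k. \<eta> i \<in> L2 \<mu>) \<and>
     (\<forall>i<k. \<forall>j<k. (\<integral>x. \<eta> i x * \<eta> j x \<partial>\<mu>) = (if i = j then 1 else 0))"

text \<open>The component of \<open>f\<close> orthogonal to the span of the system.\<close>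

definition remainder :: "'a measure \<Rightarrow> nat \<Rightarrow> (nat \<Rightarrow> 'a \<Rightarrow> real) \<Rightarrow> ('a \<Rightarrow> real) \<Rightarrow> 'a \<Rightarrow> real" where
  "remainder \<mu> k \<eta> f x = f x - (\<Sum>i<k. (\<integral>y. \<eta> i y * f y \<partial>\<mu>) * \<eta> i x)"

text \<open>The images of the singular vectors, normalised in \<open>L2\<close>, span a subspace whose orthogonal
  projection approximates as well as any use of \<open>m\<close> linear functionals. When the embedding is zero
  the system is replaced by the constant function \<open>1\<close>, which keeps its size positive.\<close>

lemma near_optimal_subspace:
  fixes APP :: "'f::{real_inner, complete_space} \<Rightarrow> 'a \<Rightarrow> real"
  assumes emb: "compact_embedding \<mu> APP" and \<mu>: "prob_space \<mu>" and m: "1 \<le> m"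
  obtains k \<eta> \<sigma> where "1 \<le> k" "k \<le> m" "orthonormal \<mu> k \<eta>" "0 \<le> \<sigma>"
    "ennreal \<sigma> \<le> e_wor \<mu> APP m Lambda_all"
    "\<And>f. norm f \<le> 1 \<Longrightarrow> (\<integral>x. (remainder \<mu> k \<eta> (APP f) x)\<^sup>2 \<partial>\<mu>) \<le> \<sigma>\<^sup>2"
proof -
  interpret compact_form "embedding_form \<mu> APP" by (rule embedding_form_compact_form[OF emb])
  note D = compact_embeddingD[OF emb]
  note [measurable] = D(1)[THEN L2_measurable]
  obtain v where v: "singular_system v" using singular_system_exists by blast
  let ?B = "embedding_form \<mu> APP"
  define k where "k = (LEAST k. k = m \<or> v k = 0)"
  have k: "k = m \<or> v k = 0" unfolding k_def by (rule LeastI[of _ m]) simp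
  have km: "k \<le> m" unfolding k_def by (rule Least_le) simp
  have kpos: "norm (v i) = 1" "?B (v i) (v i) > 0" if "i < k" for i
    using not_less_Least[of i "\<lambda>k. k = m \<or> v k = 0"] that singular_systemD(2)[OF v, of i]
    by (auto simp: k_def)
  define \<sigma> where "\<sigma> = sqrt (?B (v k) (v k))"
  have \<sigma>0: "\<sigma> \<ge> 0" by (simp add: \<sigma>_def B_nonneg)
  have \<sigma>2: "\<sigma>\<^sup>2 = ?B (v k) (v k)" by (simp add: \<sigma>_def B_nonneg)
  have \<sigma>: "ennreal \<sigma> \<le> e_wor \<mu> APP m Lambda_all"
    using k singular_value_le_e_wor[OF emb v, of m] by (auto simp: \<sigma>_def)
  show ?thesis
  proof (cases "k = 0")
    case True
    then have "f \<in> complement v k" for f by (simp add: complement_def)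
    then have "?B f f \<le> 0" for f using singular_systemD(3)[OF v, of f k] True k m by auto
    then have B0: "?B f f = 0" for f using B_nonneg[of f] by (simp add: antisym)
    have AE0: "AE x in \<mu>. APP f x = 0" for f
    proof -
      have "AE x in \<mu>. APP f x * APP f x = 0"
        using B0[of f] unfolding embedding_form_def
        by (subst (asm) integral_nonneg_eq_0_iff_AE) (auto intro: L2_integrable_mult D(1))
      then show ?thesis by simp
    qed
    interpret prob_space \<mu> by (rule \<mu>)
    show ?thesis
    proof (rule that[of 1 "\<lambda>_ _. 1" \<sigma>])
      show "orthonormal \<mu> 1 (\<lambda>_ _. 1)" by (simp add: orthonormal_def L2_def prob_space)
      fix f
      have "AE x in \<mu>. (remainder \<mu> 1 (\<lambda>_ _. 1) (APP f) x)\<^sup>2 = 0"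
      proof -
        have "(\<integral>y. APP f y \<partial>\<mu>) = 0" using AE0[of f] by (simp add: integral_eq_zero_AE)
        then show ?thesis using AE0[of f] by (auto simp: remainder_def)
      qed
      then have "(\<integral>x. (remainder \<mu> 1 (\<lambda>_ _. 1) (APP f) x)\<^sup>2 \<partial>\<mu>) = 0" by (rule integral_eq_zero_AE)
      then show "(\<integral>x. (remainder \<mu> 1 (\<lambda>_ _. 1) (APP f) x)\<^sup>2 \<partial>\<mu>) \<le> \<sigma>\<^sup>2" by simp
    qed (use m \<sigma>0 \<sigma> in auto)
  next
    case False
    define \<eta> where "\<eta> i x = APP (v i) x / sqrt (?B (v i) (v i))" for i x
    have \<eta>: "orthonormal \<mu> k \<eta>"
      unfolding orthonormal_def
    proof (intro conjI allI impI)
      fix i j assume ij: "i < k" "j < k"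
      show "\<eta> i \<in> L2 \<mu>"
        using L2_cmult[OF D(1)[of "v i"], of "1 / sqrt (?B (v i) (v i))"] by (simp add: \<eta>_def[abs_def])
      have "(\<integral>x. \<eta> i x * \<eta> j x \<partial>\<mu>) = ?B (v i) (v j) / (sqrt (?B (v i) (v i)) * sqrt (?B (v j) (v j)))"
        by (simp add: \<eta>_def embedding_form_def)
      then show "(\<integral>x. \<eta> i x * \<eta> j x \<partial>\<mu>) = (if i = j then 1 else 0)"
        using kpos(2)[OF ij(1)] by (cases "i = j") (simp_all add: singular_B[OF v])
    qed
    show ?thesis
    proof (rule that[OF _ km \<eta> \<sigma>0 \<sigma>])
      show "1 \<le> k" using False by simp
      fix f :: 'f assume f: "norm f \<le> 1"
      define h where "h = f - (\<Sum>i<k. inner (v i) f *\<^sub>R v i)"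
      have h: "h \<in> complement v k" "?B h h \<le> ?B (v k) (v k) * (norm f)\<^sup>2"
        unfolding h_def by (rule singular_remainder[OF v])+
      \<comment> \<open>The singular vectors are orthogonal for both inner products, so the projection onto
        their span in one Hilbert space is the projection onto the span of the images in the other.\<close>
      have coeff: "(\<integral>y. \<eta> i y * APP f y \<partial>\<mu>) = inner (v i) f * sqrt (?B (v i) (v i))" if i: "i < k" for i
      proof -
        have "?B (v i) f = ?B (v i) h + ?B (v i) (\<Sum>j<k. inner (v j) f *\<^sub>R v j)"
          by (simp add: h_def B_diff_right)
        also have "?B (v i) h = 0" by (rule singular_B_complement[OF v h(1) i])
        also have "?B (v i) (\<Sum>j<k. inner (v j) f *\<^sub>R v j) = (\<Sum>j<k. inner (v j) f * ?B (v i) (v j))"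
          by (simp add: B_sum_right B_scale_right)
        also have "\<dots> = (\<Sum>j<k. if j = i then inner (v i) f * ?B (v i) (v i) else 0)"
          by (intro sum.cong) (auto simp: singular_B[OF v])
        also have "\<dots> = inner (v i) f * ?B (v i) (v i)" using i by simp
        finally have "?B (v i) f = inner (v i) f * ?B (v i) (v i)" by simp
        moreover have "(\<integral>y. \<eta> i y * APP f y \<partial>\<mu>) = ?B (v i) f / sqrt (?B (v i) (v i))"
          by (simp add: \<eta>_def embedding_form_def)
        ultimately show ?thesis by (simp add: real_div_sqrt B_nonneg flip: times_divide_eq_right)
      qed
      have "(\<Sum>i<k. (\<integral>y. \<eta> i y * APP f y \<partial>\<mu>) * \<eta> i x) = (\<Sum>i<k. inner (v i) f * APP (v i) x)" for x
        proof (intro sum.cong refl)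
        fix i assume "i \<in> {..<k}"
        then have i: "i < k" by simp
        show "(\<integral>y. \<eta> i y * APP f y \<partial>\<mu>) * \<eta> i x = inner (v i) f * APP (v i) x"
          unfolding coeff[OF i] using kpos(2)[OF i] by (simp add: \<eta>_def)
      qed
      then have rem: "remainder \<mu> k \<eta> (APP f) x = APP f x - (\<Sum>i<k. inner (v i) f * APP (v i) x)" for x
        by (simp add: remainder_def)
      have "(\<integral>x. (remainder \<mu> k \<eta> (APP f) x)\<^sup>2 \<partial>\<mu>) = ?B h h"
        unfolding rem embedding_form_def
      proof (rule integral_cong_AE)
        from compact_embeddingD(4)[OF emb, of f "\<Sum>i<k. inner (v i) f *\<^sub>R v i"]
          compact_embedding_sum[OF emb, where k = k and c = "\<lambda>i. inner (v i) f" and v = v]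
        show "AE x in \<mu>. (APP f x - (\<Sum>i<k. inner (v i) f * APP (v i) x))\<^sup>2 = APP h x * APP h x"
          unfolding h_def by eventually_elim (simp add: power2_eq_square)
      qed measurable
      also have "\<dots> \<le> \<sigma>\<^sup>2 * 1"
        using h(2) mult_left_mono[OF power_le_one[OF norm_ge_zero f, of 2], of "\<sigma>\<^sup>2"]
          B_nonneg[of "v k"] by (simp add: \<sigma>2)
      finally show "(\<integral>x. (remainder \<mu> k \<eta> (APP f) x)\<^sup>2 \<partial>\<mu>) \<le> \<sigma>\<^sup>2" by simp
    qed
  qed
qed

section \<open>Projection kernels and Kaczmarz steps\<close>

definition kernel_op :: "'a measure \<Rightarrow> ('a \<Rightarrow> 'a \<Rightarrow> real) \<Rightarrow> ('a \<Rightarrow> real) \<Rightarrow> 'a \<Rightarrow> real" where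
  "kernel_op \<mu> K f x = (\<integral>y. K x y * f y \<partial>\<mu>)"

text \<open>
  The reproducing kernel of a finite-dimensional space of functions, which is the integral kernel
  of the orthogonal projection onto it. The identities hold at every point and not just almost
  everywhere, so that the kernel may be evaluated at sample points.
\<close>

definition projection_kernel :: "'a measure \<Rightarrow> ('a \<Rightarrow> 'a \<Rightarrow> real) \<Rightarrow> bool" where
  "projection_kernel \<mu> K \<longleftrightarrow> (\<forall>x. K x \<in> L2 \<mu>) \<and> (\<forall>x y. K x y = K y x) \<and>
     (\<forall>x y. kernel_op \<mu> K (K x) y = K x y)"

text \<open>One step of Gaussian elimination with pivot \<open>K x x\<close>. With \<open>0\<close> on the diagonal the whole row
  vanishes and division by \<open>0\<close> leaves \<open>K\<close> unchanged; this also keeps \<open>kaczmarz_step\<close> total.\<close>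

definition deflate :: "('a \<Rightarrow> 'a \<Rightarrow> real) \<Rightarrow> 'a \<Rightarrow> 'a \<Rightarrow> 'a \<Rightarrow> real" where
  "deflate K x y z = K y z - K y x / K x x * K x z"

text \<open>
  The update of a residual \<open>r\<close> after sampling it at \<open>x\<close>. For \<open>a = 1\<close> it is the correction by the
  multiple of \<open>K x\<close> that makes the residual vanish at \<open>x\<close>; smaller \<open>a\<close> damps the noise that is
  caused by the part of \<open>r\<close> orthogonal to the range of \<open>K\<close>.
\<close>

definition kaczmarz_step ::
  "real \<Rightarrow> ('a \<Rightarrow> 'a \<Rightarrow> real) \<Rightarrow> 'a \<Rightarrow> ('a \<Rightarrow> real) \<Rightarrow> 'a \<Rightarrow> real" where
  "kaczmarz_step a K x r y = r y - a * (r x / K x x) * K x y"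

definition has_trace :: "'a measure \<Rightarrow> ('a \<Rightarrow> 'a \<Rightarrow> real) \<Rightarrow> real \<Rightarrow> bool" where
  "has_trace \<mu> K \<rho> \<longleftrightarrow> integrable \<mu> (\<lambda>x. K x x) \<and> (\<integral>x. K x x \<partial>\<mu>) = \<rho>"

abbreviation sqnorm :: "'a measure \<Rightarrow> ('a \<Rightarrow> real) \<Rightarrow> real" where
  "sqnorm \<mu> f \<equiv> \<integral>x. (f x)\<^sup>2 \<partial>\<mu>"

lemma projection_kernelD:
  assumes "projection_kernel \<mu> K"
  shows "K x \<in> L2 \<mu>" "K x y = K y x" "kernel_op \<mu> K (K x) y = K x y"
  using assms by (auto simp: projection_kernel_def)

lemma kernel_op_linear:
  fixes f g :: "'a \<Rightarrow> real"
  assumes "K y \<in> L2 \<mu>" "f \<in> L2 \<mu>" "g \<in> L2 \<mu>"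
  shows "kernel_op \<mu> K (\<lambda>z. f z - c * g z) y = kernel_op \<mu> K f y - c * kernel_op \<mu> K g y"
proof -
  have "kernel_op \<mu> K (\<lambda>z. f z - c * g z) y = (\<integral>z. K y z * f z - c * (K y z * g z) \<partial>\<mu>)"
    unfolding kernel_op_def by (intro Bochner_Integration.integral_cong) (auto simp: algebra_simps)
  then show ?thesis using assms by (simp add: kernel_op_def L2_integrable_mult)
qed

lemma kernel_op_deflate:
  assumes K: "projection_kernel \<mu> K" and f: "f \<in> L2 \<mu>"
  shows "kernel_op \<mu> (deflate K x) f y = kernel_op \<mu> K f y - K y x / K x x * kernel_op \<mu> K f x"
proof -
  note D = projection_kernelD[OF K]
  have "kernel_op \<mu> (deflate K x) f y = (\<integral>z. K y z * f z - K y x / K x x * (K x z * f z) \<partial>\<mu>)"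
    unfolding kernel_op_def deflate_def
    by (intro Bochner_Integration.integral_cong) (auto simp: algebra_simps)
  then show ?thesis unfolding kernel_op_def using D(1) f by (simp add: L2_integrable_mult)
qed

text \<open>Deflation at \<open>x\<close> passes to the functions in the range of \<open>K\<close> that vanish at \<open>x\<close>.\<close>

lemma projection_kernel_deflate:
  assumes K: "projection_kernel \<mu> K"
  shows "projection_kernel \<mu> (deflate K x)"
proof -
  note D = projection_kernelD[OF K]
  have L: "deflate K x y \<in> L2 \<mu>" for y
    unfolding deflate_def[abs_def] by (intro L2_diff L2_cmult D)
  have sym: "deflate K x y z = deflate K x z y" for y z
    using D(2)[of y z] D(2)[of y x] D(2)[of z x] by (simp add: deflate_def)
  have "kernel_op \<mu> K (deflate K x y) z = deflate K x y z" for y z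
    unfolding deflate_def[abs_def] by (subst kernel_op_linear) (simp_all add: D(1,3))
  then have "kernel_op \<mu> (deflate K x) (deflate K x y) z = deflate K x y z - K z x / K x x * deflate K x y x" for y z
    by (simp add: kernel_op_deflate[OF K L])
  moreover have "K z x / K x x * deflate K x y x = 0" for y z by (simp add: deflate_def)
  ultimately show ?thesis using L sym by (simp add: projection_kernel_def)
qed

lemma projection_kernel_diag:
  assumes K: "projection_kernel \<mu> K"
  shows "K x x = sqnorm \<mu> (K x)" "0 \<le> K x x"
proof -
  show "K x x = sqnorm \<mu> (K x)"
    using projection_kernelD(3)[OF K, of x x] by (simp add: kernel_op_def power2_eq_square)
  then show "0 \<le> K x x" by simp
qed

text \<open>\<open>K x x\<close> is the squared norm of \<open>K x\<close>, so \<open>K x\<close> is zero almost everywhere; reproducing it by \<open>K\<close>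
  turns this into zero everywhere.\<close>

lemma projection_kernel_null:
  assumes K: "projection_kernel \<mu> K" and x: "K x x = 0"
  shows "K x y = 0"
proof -
  note D = projection_kernelD[OF K]
  have "AE z in \<mu>. (K x z)\<^sup>2 = 0"
    using integral_nonneg_eq_0_iff_AE[OF L2_integrable_square[OF D(1)[of x]]]
      x projection_kernel_diag(1)[OF K, of x] by auto
  then have "AE z in \<mu>. K y z * K x z = 0" by eventually_elim simp
  then have "kernel_op \<mu> K (K x) y = 0" unfolding kernel_op_def by (rule integral_eq_zero_AE)
  then show ?thesis using D(3) by simp
qed

lemma kaczmarz_step_L2:
  assumes "projection_kernel \<mu> K" "r \<in> L2 \<mu>"
  shows "kaczmarz_step a K x r \<in> L2 \<mu>"
  unfolding kaczmarz_step_def[abs_def]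
  by (intro L2_diff L2_cmult assms projection_kernelD[OF assms(1)])

lemma kernel_op_step:
  assumes "projection_kernel \<mu> K" "r \<in> L2 \<mu>"
    and "K' y \<in> L2 \<mu>" "kernel_op \<mu> K' (K x) y = K x y"
  shows "kernel_op \<mu> K' (kaczmarz_step a K x r) y = kernel_op \<mu> K' r y - a * (r x / K x x) * K x y"
  unfolding kaczmarz_step_def[abs_def]
  using assms by (subst kernel_op_linear) (simp_all add: projection_kernelD[OF assms(1)])

text \<open>A residual orthogonal to the range of \<open>K\<close> moves by a multiple of \<open>K x\<close>, and \<open>K x\<close> is exactly
  the direction that deflation at \<open>x\<close> removes.\<close>

lemma kernel_op_deflate_step:
  assumes K: "projection_kernel \<mu> K" and r: "r \<in> L2 \<mu>" and 0: "\<And>y. kernel_op \<mu> K r y = 0"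
  shows "kernel_op \<mu> (deflate K x) (kaczmarz_step 1 K x r) y = 0"
proof -
  note D = projection_kernelD[OF K]
  have "kernel_op \<mu> K (kaczmarz_step 1 K x r) y = - (r x / K x x) * K x y" for y
    using kernel_op_step[OF K r D(1) D(3), of 1 x y] 0 by simp
  then show ?thesis
    by (simp add: kernel_op_deflate[OF K kaczmarz_step_L2[OF K r]] D(2)[of y x])
qed

lemma sqnorm_step:
  assumes K: "projection_kernel \<mu> K" and r: "r \<in> L2 \<mu>"
  shows "K x x * sqnorm \<mu> (kaczmarz_step a K x r) \<le>
    K x x * sqnorm \<mu> r - 2 * a * (r x * kernel_op \<mu> K r x) + a\<^sup>2 * (r x)\<^sup>2"
proof (cases "K x x = 0")
  case True
  then show ?thesis by (simp add: kernel_op_def projection_kernel_null[OF K True])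
next
  case False
  note D = projection_kernelD[OF K]
  define c where "c = a * (r x / K x x)"
  have "sqnorm \<mu> (kaczmarz_step a K x r) =
      (\<integral>y. (r y)\<^sup>2 - (2 * c) * (K x y * r y) + c\<^sup>2 * (K x y)\<^sup>2 \<partial>\<mu>)"
    unfolding kaczmarz_step_def c_def[symmetric]
    by (intro Bochner_Integration.integral_cong) (auto simp: power2_eq_square algebra_simps)
  also have "\<dots> = sqnorm \<mu> r - 2 * c * kernel_op \<mu> K r x + c\<^sup>2 * K x x"
    using r D(1)[of x] unfolding projection_kernel_diag(1)[OF K, of x] kernel_op_def
    by (simp add: L2_integrable_mult L2_integrable_square)
  finally have "sqnorm \<mu> (kaczmarz_step a K x r) = \<dots>" .
  then show ?thesis using False by (simp add: c_def power2_eq_square field_simps)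
qed

text \<open>Sampling \<open>x\<close> with density \<open>K x x / \<rho>\<close> cancels the normalisation of the step, and the
  squared residual at \<open>x\<close> averages to its squared norm.\<close>

lemma expected_sqnorm_step:
  assumes K: "projection_kernel \<mu> K" and tr: "has_trace \<mu> K \<rho>" "0 < \<rho>"
    and r: "r \<in> L2 \<mu>" and int: "integrable \<mu> (\<lambda>x. r x * kernel_op \<mu> K r x)"
  shows "(\<integral>\<^sup>+x. ennreal (K x x / \<rho>) * ennreal (sqnorm \<mu> (kaczmarz_step a K x r)) \<partial>\<mu>) \<le>
    ennreal ((1 + a\<^sup>2 / \<rho>) * sqnorm \<mu> r - 2 * a / \<rho> * (\<integral>x. r x * kernel_op \<mu> K r x \<partial>\<mu>))"
proof -
  define F where "F x = (K x x * sqnorm \<mu> r - 2 * a * (r x * kernel_op \<mu> K r x) + a\<^sup>2 * (r x)\<^sup>2) / \<rho>" for x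
  have le: "K x x / \<rho> * sqnorm \<mu> (kaczmarz_step a K x r) \<le> F x" for x
    using sqnorm_step[OF K r, of x a] tr(2) by (simp add: F_def divide_right_mono)
  have F0: "0 \<le> F x" for x
    by (rule order.trans[OF _ le]) (use tr(2) projection_kernel_diag(2)[OF K, of x] in simp)
  have trD: "integrable \<mu> (\<lambda>x. K x x)" "(\<integral>x. K x x \<partial>\<mu>) = \<rho>" using tr(1) by (auto simp: has_trace_def)
  have intF: "integrable \<mu> F"
    unfolding F_def using trD(1) int L2_integrable_square[OF r] by simp
  have "(\<integral>\<^sup>+x. ennreal (K x x / \<rho>) * ennreal (sqnorm \<mu> (kaczmarz_step a K x r)) \<partial>\<mu>) \<le> (\<integral>\<^sup>+x. ennreal (F x) \<partial>\<mu>)"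
    using le tr(2) projection_kernel_diag(2)[OF K]
    by (intro nn_integral_mono) (simp add: ennreal_leI flip: ennreal_mult)
  also have "\<dots> = ennreal (\<integral>x. F x \<partial>\<mu>)"
    using intF F0 by (intro nn_integral_eq_integral) auto
  also have "(\<integral>x. F x \<partial>\<mu>) =
      (\<rho> * sqnorm \<mu> r - 2 * a * (\<integral>x. r x * kernel_op \<mu> K r x \<partial>\<mu>) + a\<^sup>2 * sqnorm \<mu> r) / \<rho>"
    unfolding F_def using trD int L2_integrable_square[OF r] by simp
  also have "\<dots> = (1 + a\<^sup>2 / \<rho>) * sqnorm \<mu> r - 2 * a / \<rho> * (\<integral>x. r x * kernel_op \<mu> K r x \<partial>\<mu>)"
    using tr(2) by (simp add: field_simps)
  finally show ?thesis .
qed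

lemma has_trace_deflate:
  assumes K: "projection_kernel \<mu> K" and tr: "has_trace \<mu> K \<rho>" and x: "K x x \<noteq> 0"
  shows "has_trace \<mu> (deflate K x) (\<rho> - 1)"
proof -
  note D = projection_kernelD[OF K]
  have d: "deflate K x y y = K y y - (K x y)\<^sup>2 / K x x" for y
    by (simp add: deflate_def D(2)[of y x] power2_eq_square)
  show ?thesis
    using tr x L2_integrable_square[OF D(1)[of x]] projection_kernel_diag(1)[OF K, of x]
    unfolding has_trace_def d by simp
qed

text \<open>The trace is the dimension of the range. When it is zero, the kernel vanishes at every point,
  which is what makes the first \<open>k\<close> sampling steps exact on the subspace.\<close>

lemma projection_kernel_trace_zero:
  assumes K: "projection_kernel \<mu> K" and tr: "has_trace \<mu> K 0"
  shows "K x y = 0"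
proof -
  note D = projection_kernelD[OF K]
  have "AE z in \<mu>. K z z = 0"
    using tr projection_kernel_diag(2)[OF K] integral_nonneg_eq_0_iff_AE[of \<mu> "\<lambda>z. K z z"]
    unfolding has_trace_def by auto
  then have "AE z in \<mu>. K y z * K x z = 0"
  proof eventually_elim
    case (elim z)
    then show ?case using projection_kernel_null[OF K elim, of y] D(2)[of y z] by simp
  qed
  then have "kernel_op \<mu> K (K x) y = 0" unfolding kernel_op_def by (rule integral_eq_zero_AE)
  then show ?thesis using D(3) by simp
qed

definition basis_kernel :: "nat \<Rightarrow> (nat \<Rightarrow> 'a \<Rightarrow> real) \<Rightarrow> 'a \<Rightarrow> 'a \<Rightarrow> real" where
  "basis_kernel k \<eta> x y = (\<Sum>i<k. \<eta> i x * \<eta> i y)"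

lemma orthonormalD:
  assumes "orthonormal \<mu> k \<eta>"
  shows "i < k \<Longrightarrow> \<eta> i \<in> L2 \<mu>"
    and "i < k \<Longrightarrow> j < k \<Longrightarrow> (\<integral>x. \<eta> i x * \<eta> j x \<partial>\<mu>) = (if i = j then 1 else 0)"
  using assms by (auto simp: orthonormal_def)

lemma orthonormal_integral_sum:
  assumes on: "orthonormal \<mu> k \<eta>" and i: "i < k"
  shows "(\<integral>y. \<eta> i y * (\<Sum>j<k. c j * \<eta> j y) \<partial>\<mu>) = c i"
proof -
  note D = orthonormalD[OF on]
  have "(\<integral>y. \<eta> i y * (\<Sum>j<k. c j * \<eta> j y) \<partial>\<mu>) = (\<integral>y. (\<Sum>j<k. c j * (\<eta> i y * \<eta> j y)) \<partial>\<mu>)"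
    by (simp add: sum_distrib_left mult_ac)
  also have "\<dots> = (\<Sum>j<k. c j * (\<integral>y. \<eta> i y * \<eta> j y \<partial>\<mu>))"
    using i by (subst Bochner_Integration.integral_sum) (auto intro!: L2_integrable_mult D(1))
  also have "\<dots> = (\<Sum>j<k. if j = i then c i else 0)"
    by (intro sum.cong) (use i D(2) in auto)
  also have "\<dots> = c i" using i by simp
  finally show ?thesis .
qed

lemma orthonormal_sqnorm_sum:
  assumes on: "orthonormal \<mu> k \<eta>"
  shows "sqnorm \<mu> (\<lambda>y. \<Sum>j<k. c j * \<eta> j y) = (\<Sum>j<k. (c j)\<^sup>2)"
proof -
  note D = orthonormalD[OF on]
  have "sqnorm \<mu> (\<lambda>y. \<Sum>j<k. c j * \<eta> j y) = (\<integral>y. (\<Sum>i<k. c i * (\<eta> i y * (\<Sum>j<k. c j * \<eta> j y))) \<partial>\<mu>)"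
    by (simp add: power2_eq_square sum_distrib_right mult_ac)
  also have "\<dots> = (\<Sum>i<k. c i * (\<integral>y. \<eta> i y * (\<Sum>j<k. c j * \<eta> j y) \<partial>\<mu>))"
    by (subst Bochner_Integration.integral_sum)
      (auto intro!: L2_integrable_mult L2_sum L2_cmult D(1))
  also have "\<dots> = (\<Sum>j<k. (c j)\<^sup>2)"
    by (simp add: orthonormal_integral_sum[OF on] power2_eq_square)
  finally show ?thesis .
qed

lemma kernel_op_basis:
  assumes on: "orthonormal \<mu> k \<eta>" and f: "f \<in> L2 \<mu>"
  shows "kernel_op \<mu> (basis_kernel k \<eta>) f x = (\<Sum>i<k. (\<integral>y. \<eta> i y * f y \<partial>\<mu>) * \<eta> i x)"
proof -
  note D = orthonormalD[OF on]
  have "kernel_op \<mu> (basis_kernel k \<eta>) f x = (\<integral>y. (\<Sum>i<k. \<eta> i x * (\<eta> i y * f y)) \<partial>\<mu>)"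
    by (simp add: kernel_op_def basis_kernel_def sum_distrib_right mult.assoc)
  also have "\<dots> = (\<Sum>i<k. \<eta> i x * (\<integral>y. \<eta> i y * f y \<partial>\<mu>))"
    by (subst Bochner_Integration.integral_sum) (auto intro!: L2_integrable_mult D(1) f)
  finally show ?thesis by (simp add: mult.commute)
qed

lemma projection_kernel_basis:
  assumes on: "orthonormal \<mu> k \<eta>"
  shows "projection_kernel \<mu> (basis_kernel k \<eta>)"
proof -
  have L: "basis_kernel k \<eta> x \<in> L2 \<mu>" for x
    unfolding basis_kernel_def[abs_def] by (intro L2_sum L2_cmult orthonormalD[OF on]) simp
  moreover have "kernel_op \<mu> (basis_kernel k \<eta>) (basis_kernel k \<eta> x) y = basis_kernel k \<eta> x y" for x y
    unfolding kernel_op_basis[OF on L] basis_kernel_def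
    by (simp add: orthonormal_integral_sum[OF on])
  ultimately show ?thesis by (simp add: projection_kernel_def basis_kernel_def mult.commute)
qed

lemma has_trace_basis:
  assumes on: "orthonormal \<mu> k \<eta>"
  shows "has_trace \<mu> (basis_kernel k \<eta>) (real k)"
  unfolding has_trace_def basis_kernel_def
  using orthonormalD[OF on] by (auto intro!: L2_integrable_mult simp: L2_integrable_mult)

lemma remainder_eq:
  assumes "orthonormal \<mu> k \<eta>" "f \<in> L2 \<mu>"
  shows "remainder \<mu> k \<eta> f x = f x - kernel_op \<mu> (basis_kernel k \<eta>) f x"
  by (simp add: remainder_def kernel_op_basis[OF assms])

lemma remainder_L2:
  assumes "orthonormal \<mu> k \<eta>" "f \<in> L2 \<mu>"
  shows "remainder \<mu> k \<eta> f \<in> L2 \<mu>"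
  unfolding remainder_def[abs_def]
  by (intro L2_diff assms(2) L2_sum L2_cmult orthonormalD[OF assms(1)]) simp

lemma kernel_op_remainder:
  assumes on: "orthonormal \<mu> k \<eta>" and f: "f \<in> L2 \<mu>"
  shows "kernel_op \<mu> (basis_kernel k \<eta>) (remainder \<mu> k \<eta> f) x = 0"
proof -
  have L: "(\<lambda>x. \<Sum>i<k. (\<integral>y. \<eta> i y * f y \<partial>\<mu>) * \<eta> i x) \<in> L2 \<mu>"
    by (intro L2_sum L2_cmult orthonormalD[OF on]) simp
  show ?thesis
    unfolding remainder_def[abs_def]
    using kernel_op_linear[OF projection_kernelD(1)[OF projection_kernel_basis[OF on]] f L, where c = 1]
    by (simp add: kernel_op_basis[OF on L] kernel_op_basis[OF on f] orthonormal_integral_sum[OF on])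
qed

text \<open>Pythagoras, with the projection written through its kernel.\<close>

lemma integral_mult_kernel_op_basis:
  assumes on: "orthonormal \<mu> k \<eta>" and f: "f \<in> L2 \<mu>"
  shows "integrable \<mu> (\<lambda>x. f x * kernel_op \<mu> (basis_kernel k \<eta>) f x)"
    and "(\<integral>x. f x * kernel_op \<mu> (basis_kernel k \<eta>) f x \<partial>\<mu>) = sqnorm \<mu> f - sqnorm \<mu> (remainder \<mu> k \<eta> f)"
proof -
  define c where "c i = (\<integral>y. \<eta> i y * f y \<partial>\<mu>)" for i
  define p where "p = (\<lambda>x. \<Sum>i<k. c i * \<eta> i x)"
  have p: "p \<in> L2 \<mu>" unfolding p_def by (intro L2_sum L2_cmult orthonormalD[OF on]) simp
  have op: "kernel_op \<mu> (basis_kernel k \<eta>) f x = p x" for x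
    by (simp add: kernel_op_basis[OF on f] p_def c_def)
  show "integrable \<mu> (\<lambda>x. f x * kernel_op \<mu> (basis_kernel k \<eta>) f x)"
    unfolding op by (intro L2_integrable_mult f p)
  have "(\<integral>x. f x * p x \<partial>\<mu>) = (\<integral>x. (\<Sum>i<k. c i * (\<eta> i x * f x)) \<partial>\<mu>)"
    by (simp add: p_def sum_distrib_left mult_ac)
  also have "\<dots> = (\<Sum>i<k. c i * c i)"
    unfolding c_def
    by (subst Bochner_Integration.integral_sum) (auto intro!: L2_integrable_mult f orthonormalD[OF on])
  also have "\<dots> = sqnorm \<mu> p"
    unfolding p_def orthonormal_sqnorm_sum[OF on] by (simp add: power2_eq_square)
  finally have fp: "(\<integral>x. f x * p x \<partial>\<mu>) = sqnorm \<mu> p" .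
  have "sqnorm \<mu> (remainder \<mu> k \<eta> f) = (\<integral>x. (f x)\<^sup>2 - 2 * (f x * p x) + (p x)\<^sup>2 \<partial>\<mu>)"
    by (simp add: remainder_def p_def c_def power2_diff mult.assoc algebra_simps)
  also have "\<dots> = sqnorm \<mu> f - 2 * (\<integral>x. f x * p x \<partial>\<mu>) + sqnorm \<mu> p"
    by (simp add: L2_integrable_mult L2_integrable_square f p)
  finally show "(\<integral>x. f x * kernel_op \<mu> (basis_kernel k \<eta>) f x \<partial>\<mu>) = sqnorm \<mu> f - sqnorm \<mu> (remainder \<mu> k \<eta> f)"
    unfolding op fp by simp
qed

section \<open>The sampling algorithm\<close>

lemma ennsqrt_le: "x \<le> ennreal (c\<^sup>2) \<Longrightarrow> 0 \<le> c \<Longrightarrow> ennsqrt x \<le> ennreal c"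
proof -
  assume x: "x \<le> ennreal (c\<^sup>2)" and c: "0 \<le> c"
  then have "x \<noteq> \<top>" by (auto simp: top_unique)
  moreover have "sqrt (enn2real x) \<le> c"
    using enn2real_mono[OF x] c by (intro real_le_lsqrt) auto
  ultimately show ?thesis by (simp add: ennsqrt_def ennreal_leI)
qed

locale kaczmarz = prob_space \<mu> for \<mu> :: "'a measure" +
  fixes k :: nat and \<eta> :: "nat \<Rightarrow> 'a \<Rightarrow> real"
  assumes k_pos: "1 \<le> k" and orthonormal: "orthonormal \<mu> k \<eta>"
begin

text \<open>
  \<open>excess i\<close> bounds the relative excess of the mean squared error over the squared best
  approximation error, \<open>i\<close> steps after deflation. A step of size \<open>a\<close> takes a bound \<open>u\<close> to
  \<open>u - (2 a u - a\<^sup>2 (1 + u)) / k\<close>; the choice \<open>a = u / (1 + u)\<close> minimises this and gives the recursion.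
\<close>

primrec excess :: "nat \<Rightarrow> real" where
  "excess 0 = real k"
| "excess (Suc i) = excess i - (excess i)\<^sup>2 / (real k * (1 + excess i))"

definition stepsize :: "nat \<Rightarrow> real" where
  "stepsize t = (if t < k then 1 else excess (t - k) / (1 + excess (t - k)))"

primrec deflated :: "nat \<Rightarrow> (nat \<Rightarrow> 'a) \<Rightarrow> 'a \<Rightarrow> 'a \<Rightarrow> real" where
  "deflated 0 \<xi> = basis_kernel k \<eta>"
| "deflated (Suc t) \<xi> = deflate (deflated t \<xi>) (\<xi> t)"

text \<open>The first \<open>k\<close> steps use the deflated kernels, whose dimension drops by one each time; all later
  steps use the kernel of the full subspace.\<close>

definition step_kernel :: "nat \<Rightarrow> (nat \<Rightarrow> 'a) \<Rightarrow> 'a \<Rightarrow> 'a \<Rightarrow> real" where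
  "step_kernel t \<xi> = (if t < k then deflated t \<xi> else basis_kernel k \<eta>)"

definition step_rank :: "nat \<Rightarrow> real" where
  "step_rank t = real (if t < k then k - t else k)"

text \<open>Joint density of the first \<open>t\<close> points: given the previous points, the next one is drawn with
  density proportional to the diagonal of the current kernel, whose integral is the dimension. For
  \<open>t \<le> k\<close> this is the determinantal point process of the subspace.\<close>

definition sampling_density :: "nat \<Rightarrow> (nat \<Rightarrow> 'a) \<Rightarrow> real" where
  "sampling_density t \<xi> = (\<Prod>s<t. step_kernel s \<xi> (\<xi> s) (\<xi> s) / step_rank s)"

text \<open>The output is a function of the points \<open>\<xi>\<close> and of the sampled values \<open>a\<close> alone; the analysis is
  in terms of \<open>residual\<close>, which knows \<open>f\<close>.\<close>

primrec approx :: "nat \<Rightarrow> (nat \<Rightarrow> 'a) \<Rightarrow> (nat \<Rightarrow> real) \<Rightarrow> 'a \<Rightarrow> real" where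
  "approx 0 \<xi> a = (\<lambda>_. 0)"
| "approx (Suc t) \<xi> a = (\<lambda>y. approx t \<xi> a y +
     stepsize t * ((a t - approx t \<xi> a (\<xi> t)) / step_kernel t \<xi> (\<xi> t) (\<xi> t)) * step_kernel t \<xi> (\<xi> t) y)"

definition residual :: "nat \<Rightarrow> (nat \<Rightarrow> 'a) \<Rightarrow> ('a \<Rightarrow> real) \<Rightarrow> 'a \<Rightarrow> real" where
  "residual t \<xi> f y = f y - approx t \<xi> (\<lambda>j. f (\<xi> j)) y"

lemma residual_0: "residual 0 \<xi> f = f"
  by (simp add: residual_def fun_eq_iff)

lemma residual_Suc: "residual (Suc t) \<xi> f = kaczmarz_step (stepsize t) (step_kernel t \<xi>) (\<xi> t) (residual t \<xi> f)"
  by (simp add: residual_def kaczmarz_step_def fun_eq_iff)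

lemma deflated_projection_kernel: "projection_kernel \<mu> (deflated t \<xi>)"
  by (induction t) (simp_all add: projection_kernel_basis[OF orthonormal] projection_kernel_deflate)

lemma step_kernel_projection_kernel: "projection_kernel \<mu> (step_kernel t \<xi>)"
  by (simp add: step_kernel_def deflated_projection_kernel projection_kernel_basis[OF orthonormal])

lemma residual_L2: "f \<in> L2 \<mu> \<Longrightarrow> residual t \<xi> f \<in> L2 \<mu>"
  by (induction t) (simp_all add: residual_0 residual_Suc kaczmarz_step_L2 step_kernel_projection_kernel)

lemma step_rank_pos: "0 < step_rank t"
  using k_pos by (simp add: step_rank_def)

lemma step_kernel_diag_nonneg: "0 \<le> step_kernel t \<xi> x x"
  by (rule projection_kernel_diag(2)[OF step_kernel_projection_kernel])

lemma sampling_density_nonneg: "0 \<le> sampling_density t \<xi>"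
  unfolding sampling_density_def using step_kernel_diag_nonneg step_rank_pos by (intro prod_nonneg) (simp add: less_imp_le)

lemma sampling_density_Suc: "sampling_density (Suc t) \<xi> = sampling_density t \<xi> * (step_kernel t \<xi> (\<xi> t) (\<xi> t) / step_rank t)"
  by (simp add: sampling_density_def)

lemma kernel_op_basis_deflated:
  "kernel_op \<mu> (basis_kernel k \<eta>) (deflated t \<xi> x) y = deflated t \<xi> x y"
proof (induction t arbitrary: x y)
  case 0
  then show ?case by (simp add: projection_kernelD(3)[OF projection_kernel_basis[OF orthonormal]])
next
  case (Suc t)
  note P = projection_kernelD[OF deflated_projection_kernel]
  have "kernel_op \<mu> (basis_kernel k \<eta>) (\<lambda>z. deflated t \<xi> x z - c * deflated t \<xi> (\<xi> t) z) y =
      deflated t \<xi> x y - c * deflated t \<xi> (\<xi> t) y" for c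
    by (subst kernel_op_linear)
      (simp_all add: Suc P(1) projection_kernelD(1)[OF projection_kernel_basis[OF orthonormal]])
  then show ?case unfolding deflated.simps deflate_def[abs_def] .
qed

lemma kernel_op_basis_step_kernel:
  "kernel_op \<mu> (basis_kernel k \<eta>) (step_kernel t \<xi> x) y = step_kernel t \<xi> x y"
  by (simp add: step_kernel_def kernel_op_basis_deflated
      projection_kernelD(3)[OF projection_kernel_basis[OF orthonormal]])

text \<open>All corrections are multiples of functions in the subspace, so the part of the residual
  orthogonal to it never changes.\<close>

lemma remainder_residual:
  assumes f: "f \<in> L2 \<mu>"
  shows "remainder \<mu> k \<eta> (residual t \<xi> f) = remainder \<mu> k \<eta> f"
proof (induction t)
  case (Suc t)
  have "remainder \<mu> k \<eta> (residual (Suc t) \<xi> f) y = remainder \<mu> k \<eta> (residual t \<xi> f) y" for y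
    unfolding remainder_eq[OF orthonormal residual_L2[OF f]] unfolding residual_Suc
    by (subst kernel_op_step)
      (simp_all add: step_kernel_projection_kernel residual_L2 f kernel_op_basis_step_kernel kaczmarz_step_def
        projection_kernelD(1)[OF projection_kernel_basis[OF orthonormal]])
  then show ?case using Suc by (simp add: fun_eq_iff)
qed (simp add: residual_0)

text \<open>During the first \<open>k\<close> steps the residual is linear in \<open>f\<close>. Its part coming from the projection of
  \<open>f\<close> onto the subspace is the deflated kernel applied to \<open>f\<close>, since a step of size \<open>1\<close> and
  deflation are the same formula; this part is gone when the kernel is.\<close>

lemma residual_decomposition:
  assumes f: "f \<in> L2 \<mu>" and "t \<le> k"
  shows "residual t \<xi> f y = residual t \<xi> (remainder \<mu> k \<eta> f) y + kernel_op \<mu> (deflated t \<xi>) f y"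
  using assms(2)
proof (induction t arbitrary: y)
  case 0
  then show ?case by (simp add: residual_0 remainder_eq[OF orthonormal f])
next
  case (Suc t)
  note P = projection_kernelD[OF deflated_projection_kernel]
  have "step_kernel t \<xi> = deflated t \<xi>" "stepsize t = 1" using Suc.prems by (simp_all add: step_kernel_def stepsize_def)
  then show ?case
    using Suc by (simp add: residual_Suc kaczmarz_step_def kernel_op_deflate[OF deflated_projection_kernel f]
        P(2)[of _ _ y "\<xi> t"] add_divide_distrib algebra_simps)
qed

text \<open>The other part stays orthogonal to the range of the current kernel, so the mixed term in
  the expected squared norm of the next residual vanishes.\<close>

lemma kernel_op_deflated_residual_remainder:
  assumes f: "f \<in> L2 \<mu>" and "t \<le> k"
  shows "kernel_op \<mu> (deflated t \<xi>) (residual t \<xi> (remainder \<mu> k \<eta> f)) y = 0"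
  using assms(2)
proof (induction t arbitrary: y)
  case 0
  then show ?case by (simp add: residual_0 kernel_op_remainder[OF orthonormal f])
next
  case (Suc t)
  have "step_kernel t \<xi> = deflated t \<xi>" "stepsize t = 1" using Suc.prems by (simp_all add: step_kernel_def stepsize_def)
  then show ?case
    using kernel_op_deflate_step[OF deflated_projection_kernel residual_L2[OF remainder_L2[OF orthonormal f]], of t \<xi> t \<xi>] Suc
    by (simp add: residual_Suc)
qed

text \<open>A point where the kernel vanishes would not lower the dimension, but such points have
  density \<open>0\<close>.\<close>

lemma deflated_trace:
  assumes "t \<le> k" "sampling_density t \<xi> \<noteq> 0"
  shows "has_trace \<mu> (deflated t \<xi>) (real (k - t))"
  using assms
proof (induction t)
  case 0
  then show ?case by (simp add: has_trace_basis[OF orthonormal])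
next
  case (Suc t)
  have "step_kernel t \<xi> = deflated t \<xi>" using Suc.prems by (simp add: step_kernel_def)
  then have "sampling_density t \<xi> \<noteq> 0" "deflated t \<xi> (\<xi> t) (\<xi> t) \<noteq> 0"
    using Suc.prems(2) by (auto simp: sampling_density_Suc)
  then have "has_trace \<mu> (deflated (Suc t) \<xi>) (real (k - t) - 1)"
    using Suc has_trace_deflate[OF deflated_projection_kernel] by simp
  then show ?case using Suc.prems(1) by (simp add: of_nat_diff algebra_simps)
qed

lemma step_kernel_trace: "sampling_density t \<xi> \<noteq> 0 \<Longrightarrow> has_trace \<mu> (step_kernel t \<xi>) (step_rank t)"
  using deflated_trace[of t \<xi>] has_trace_basis[OF orthonormal] by (simp add: step_kernel_def step_rank_def)

lemma residual_after_deflation: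
  assumes "f \<in> L2 \<mu>" "sampling_density k \<xi> \<noteq> 0"
  shows "residual k \<xi> f = residual k \<xi> (remainder \<mu> k \<eta> f)"
proof
  fix y
  have "has_trace \<mu> (deflated k \<xi>) 0" using deflated_trace[of k \<xi>] assms(2) by simp
  then have "kernel_op \<mu> (deflated k \<xi>) f y = 0"
    by (simp add: kernel_op_def projection_kernel_trace_zero[OF deflated_projection_kernel])
  then show "residual k \<xi> f y = residual k \<xi> (remainder \<mu> k \<eta> f) y"
    using residual_decomposition[OF assms(1) order.refl] by simp
qed

lemma deflated_cong: "(\<And>s. s < t \<Longrightarrow> \<xi> s = \<xi>' s) \<Longrightarrow> deflated t \<xi> = deflated t \<xi>'"
  by (induction t) simp_all

lemma step_kernel_cong: "(\<And>s. s < t \<Longrightarrow> \<xi> s = \<xi>' s) \<Longrightarrow> step_kernel t \<xi> = step_kernel t \<xi>'"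
  using deflated_cong[of t \<xi> \<xi>'] by (simp add: step_kernel_def)

lemma sampling_density_cong:
  assumes "\<And>s. s < t \<Longrightarrow> \<xi> s = \<xi>' s"
  shows "sampling_density t \<xi> = sampling_density t \<xi>'"
  unfolding sampling_density_def
proof (intro prod.cong refl)
  fix s assume "s \<in> {..<t}"
  then have "step_kernel s \<xi> = step_kernel s \<xi>'" "\<xi> s = \<xi>' s" using assms by (auto intro!: step_kernel_cong)
  then show "step_kernel s \<xi> (\<xi> s) (\<xi> s) / step_rank s = step_kernel s \<xi>' (\<xi>' s) (\<xi>' s) / step_rank s" by simp
qed

lemma approx_cong:
  "(\<And>s. s < t \<Longrightarrow> \<xi> s = \<xi>' s) \<Longrightarrow> (\<And>s. s < t \<Longrightarrow> a s = a' s) \<Longrightarrow> approx t \<xi> a = approx t \<xi>' a'"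
proof (induction t)
  case (Suc t)
  have "approx t \<xi> a = approx t \<xi>' a'" "step_kernel t \<xi> = step_kernel t \<xi>'" "\<xi> t = \<xi>' t" "a t = a' t"
    using Suc by (auto intro!: Suc.IH step_kernel_cong)
  then show ?case by simp
qed simp

lemma residual_cong: "(\<And>s. s < t \<Longrightarrow> \<xi> s = \<xi>' s) \<Longrightarrow> residual t \<xi> f = residual t \<xi>' f"
  using approx_cong[of t \<xi> \<xi>' "\<lambda>j. f (\<xi> j)" "\<lambda>j. f (\<xi>' j)"] by (simp add: residual_def fun_eq_iff)

abbreviation points :: "nat \<Rightarrow> (nat \<Rightarrow> 'a) measure" where
  "points n \<equiv> (\<Pi>\<^sub>M j\<in>{..<n}. \<mu>)"

lemma measurable_point: "g \<in> N \<rightarrow>\<^sub>M points n \<Longrightarrow> t < n \<Longrightarrow> (\<lambda>w. g w t) \<in> N \<rightarrow>\<^sub>M \<mu>"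
  by (rule measurable_compose[OF _ measurable_component_singleton]) auto

lemma basis_kernel_measurable:
  assumes "a \<in> N \<rightarrow>\<^sub>M \<mu>" "b \<in> N \<rightarrow>\<^sub>M \<mu>"
  shows "(\<lambda>w. basis_kernel k \<eta> (a w) (b w)) \<in> borel_measurable N"
  unfolding basis_kernel_def
proof (intro borel_measurable_sum borel_measurable_times)
  fix i assume "i \<in> {..<k}"
  then have "\<eta> i \<in> borel_measurable \<mu>" using orthonormalD(1)[OF orthonormal] L2_measurable by auto
  then show "(\<lambda>w. \<eta> i (a w)) \<in> borel_measurable N" "(\<lambda>w. \<eta> i (b w)) \<in> borel_measurable N"
    using measurable_compose assms by blast+
qed

lemma deflated_measurable:
  assumes "g \<in> N \<rightarrow>\<^sub>M points n" "t \<le> n" "a \<in> N \<rightarrow>\<^sub>M \<mu>" "b \<in> N \<rightarrow>\<^sub>M \<mu>"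
  shows "(\<lambda>w. deflated t (g w) (a w) (b w)) \<in> borel_measurable N"
  using assms(2-)
proof (induction t arbitrary: a b)
  case 0
  then show ?case by (simp add: basis_kernel_measurable)
next
  case (Suc t)
  have p: "(\<lambda>w. g w t) \<in> N \<rightarrow>\<^sub>M \<mu>" using measurable_point[OF assms(1)] Suc.prems by simp
  show ?case
    unfolding deflated.simps deflate_def
    by (intro borel_measurable_diff borel_measurable_times borel_measurable_divide Suc.IH p Suc.prems)
      (use Suc.prems in simp_all)
qed

lemma step_kernel_measurable:
  assumes "g \<in> N \<rightarrow>\<^sub>M points n" "t \<le> n" "a \<in> N \<rightarrow>\<^sub>M \<mu>" "b \<in> N \<rightarrow>\<^sub>M \<mu>"
  shows "(\<lambda>w. step_kernel t (g w) (a w) (b w)) \<in> borel_measurable N"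
  using deflated_measurable[OF assms] basis_kernel_measurable[OF assms(3,4)]
  by (cases "t < k") (simp_all add: step_kernel_def)

lemma sampling_density_measurable: "t \<le> n \<Longrightarrow> sampling_density t \<in> borel_measurable (points n)"
  unfolding sampling_density_def[abs_def]
  by (intro borel_measurable_prod borel_measurable_divide step_kernel_measurable[where n = n] measurable_point[where n = n])
    auto

lemma residual_measurable:
  assumes "g \<in> N \<rightarrow>\<^sub>M points n" "t \<le> n" "f \<in> L2 \<mu>" "b \<in> N \<rightarrow>\<^sub>M \<mu>"
  shows "(\<lambda>w. residual t (g w) f (b w)) \<in> borel_measurable N"
  using assms(2,4)
proof (induction t arbitrary: b)
  case 0
  then show ?case using measurable_compose[OF _ L2_measurable[OF assms(3)]] by (simp add: residual_0)
next
  case (Suc t)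
  have p: "(\<lambda>w. g w t) \<in> N \<rightarrow>\<^sub>M \<mu>" using measurable_point[OF assms(1)] Suc.prems by simp
  have t: "t \<le> n" using Suc.prems by simp
  show ?case
    unfolding residual_Suc kaczmarz_step_def
    by (intro borel_measurable_diff borel_measurable_times borel_measurable_divide borel_measurable_const
        Suc.IH p Suc.prems t step_kernel_measurable[OF assms(1)])
qed

lemma sqnorm_residual_measurable:
  assumes "t \<le> n" "f \<in> L2 \<mu>"
  shows "(\<lambda>\<xi>. sqnorm \<mu> (residual t \<xi> f)) \<in> borel_measurable (points n)"
proof (rule borel_measurable_lebesgue_integral)
  have "(\<lambda>w. residual t (fst w) f (snd w)) \<in> borel_measurable (points n \<Otimes>\<^sub>M \<mu>)"
    by (rule residual_measurable[where n = n]) (use assms in auto)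
  then show "(\<lambda>(\<xi>, y). (residual t \<xi> f y)\<^sup>2) \<in> borel_measurable (points n \<Otimes>\<^sub>M \<mu>)"
    by (simp add: case_prod_beta)
qed

section \<open>Expectations under the sampling density\<close>

text \<open>The last point is integrated out first; the factors of the density for the earlier points do
  not depend on it.\<close>

lemma points_Suc_integral:
  assumes F: "F \<in> borel_measurable (points (Suc t))"
  shows "(\<integral>\<^sup>+\<xi>. ennreal (sampling_density (Suc t) \<xi>) * F \<xi> \<partial>points (Suc t)) =
    (\<integral>\<^sup>+\<xi>. ennreal (sampling_density t \<xi>) * (\<integral>\<^sup>+x. ennreal (step_kernel t \<xi> x x / step_rank t) * F (\<xi>(t := x)) \<partial>\<mu>) \<partial>points t)"
proof -
  interpret P: product_sigma_finite "\<lambda>_::nat. \<mu>" by standard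
  have set: "{..<Suc t} = insert t {..<t}" by auto
  have dF: "(\<lambda>\<xi>. ennreal (sampling_density (Suc t) \<xi>) * F \<xi>) \<in> borel_measurable (points (Suc t))"
    using sampling_density_measurable[of "Suc t" "Suc t"] F by measurable
  have "(\<integral>\<^sup>+\<xi>. ennreal (sampling_density (Suc t) \<xi>) * F \<xi> \<partial>points (Suc t)) =
      (\<integral>\<^sup>+\<xi>. (\<integral>\<^sup>+x. ennreal (sampling_density (Suc t) (\<xi>(t := x))) * F (\<xi>(t := x)) \<partial>\<mu>) \<partial>points t)"
    using dF unfolding set by (subst P.product_nn_integral_insert) auto
  also have "\<dots> = (\<integral>\<^sup>+\<xi>. ennreal (sampling_density t \<xi>) * (\<integral>\<^sup>+x. ennreal (step_kernel t \<xi> x x / step_rank t) * F (\<xi>(t := x)) \<partial>\<mu>) \<partial>points t)"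
  proof (rule nn_integral_cong)
    fix \<xi> assume \<xi>: "\<xi> \<in> space (points t)"
    have upd: "(\<lambda>x. \<xi>(t := x)) \<in> \<mu> \<rightarrow>\<^sub>M points (Suc t)"
      unfolding set by (rule measurable_fun_upd[where J = "{..<t}"]) (use \<xi> in auto)
    have id: "(\<lambda>x. \<xi>) \<in> \<mu> \<rightarrow>\<^sub>M points t" using \<xi> by simp
    have "(\<lambda>x. step_kernel t \<xi> x x / step_rank t) \<in> borel_measurable \<mu>"
      by (intro borel_measurable_divide step_kernel_measurable[OF id]) auto
    then have "(\<lambda>x. ennreal (step_kernel t \<xi> x x / step_rank t) * F (\<xi>(t := x))) \<in> borel_measurable \<mu>"
      using measurable_compose[OF upd F] by measurable
    moreover have "ennreal (sampling_density (Suc t) (\<xi>(t := x))) = ennreal (sampling_density t \<xi>) * ennreal (step_kernel t \<xi> x x / step_rank t)" for x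
    proof -
      have "sampling_density t (\<xi>(t := x)) = sampling_density t \<xi>" "step_kernel t (\<xi>(t := x)) = step_kernel t \<xi>"
        by (auto intro!: sampling_density_cong step_kernel_cong)
      then show ?thesis
        using sampling_density_nonneg[of t \<xi>] step_kernel_diag_nonneg[of t \<xi> x] step_rank_pos[of t]
        by (simp add: sampling_density_Suc flip: ennreal_mult)
    qed
    ultimately show "(\<integral>\<^sup>+x. ennreal (sampling_density (Suc t) (\<xi>(t := x))) * F (\<xi>(t := x)) \<partial>\<mu>) =
        ennreal (sampling_density t \<xi>) * (\<integral>\<^sup>+x. ennreal (step_kernel t \<xi> x x / step_rank t) * F (\<xi>(t := x)) \<partial>\<mu>)"
      by (simp add: mult.assoc nn_integral_cmult)
  qed
  finally show ?thesis .
qed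

lemma sampling_density_total: "(\<integral>\<^sup>+\<xi>. ennreal (sampling_density t \<xi>) \<partial>points t) = 1"
proof (induction t)
  case 0
  then show ?case by (simp add: sampling_density_def nn_integral_empty PiM_empty)
next
  case (Suc t)
  have "(\<integral>\<^sup>+\<xi>. ennreal (sampling_density (Suc t) \<xi>) \<partial>points (Suc t)) =
      (\<integral>\<^sup>+\<xi>. ennreal (sampling_density t \<xi>) * (\<integral>\<^sup>+x. ennreal (step_kernel t \<xi> x x / step_rank t) \<partial>\<mu>) \<partial>points t)"
    using points_Suc_integral[of "\<lambda>_. 1" t] by simp
  also have "\<dots> = (\<integral>\<^sup>+\<xi>. ennreal (sampling_density t \<xi>) \<partial>points t)"
  proof (rule nn_integral_cong)
    fix \<xi>
    show "ennreal (sampling_density t \<xi>) * (\<integral>\<^sup>+x. ennreal (step_kernel t \<xi> x x / step_rank t) \<partial>\<mu>) = ennreal (sampling_density t \<xi>)"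
    proof (cases "sampling_density t \<xi> = 0")
      case False
      then have "(\<integral>\<^sup>+x. ennreal (step_kernel t \<xi> x x / step_rank t) \<partial>\<mu>) = ennreal (\<integral>x. step_kernel t \<xi> x x / step_rank t \<partial>\<mu>)"
        using step_kernel_trace[OF False] step_kernel_diag_nonneg step_rank_pos[of t]
        by (intro nn_integral_eq_integral) (auto simp: has_trace_def)
      also have "\<dots> = 1" using step_kernel_trace[OF False] step_rank_pos[of t] by (simp add: has_trace_def)
      finally show ?thesis by simp
    qed simp
  qed
  finally show ?case using Suc by simp
qed

text \<open>Transfers a conditional estimate for one step, given the points so far, to the full
  expectations. The estimate is needed only where the density is positive, as the trace of the
  kernel is known only there.\<close>

lemma expected_step:
  assumes f: "f \<in> L2 \<mu>"
    and step: "\<And>\<xi>. sampling_density t \<xi> \<noteq> 0 \<Longrightarrow>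
      (\<integral>\<^sup>+x. ennreal (step_kernel t \<xi> x x / step_rank t) *
        ennreal (sqnorm \<mu> (kaczmarz_step (stepsize t) (step_kernel t \<xi>) x (residual t \<xi> f))) \<partial>\<mu>)
      \<le> ennreal (c * sqnorm \<mu> (residual t \<xi> f) + d)"
    and c: "0 \<le> c" and d: "0 \<le> d" and b: "0 \<le> b"
    and IH: "(\<integral>\<^sup>+\<xi>. ennreal (sampling_density t \<xi>) * ennreal (sqnorm \<mu> (residual t \<xi> f)) \<partial>points t) \<le> ennreal b"
  shows "(\<integral>\<^sup>+\<xi>. ennreal (sampling_density (Suc t) \<xi>) * ennreal (sqnorm \<mu> (residual (Suc t) \<xi> f)) \<partial>points (Suc t))
    \<le> ennreal (c * b + d)"
proof -
  have m: "(\<lambda>\<xi>. ennreal (sqnorm \<mu> (residual (Suc t) \<xi> f))) \<in> borel_measurable (points (Suc t))"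
    using sqnorm_residual_measurable[OF order.refl f, of "Suc t"] by measurable
  have m1: "(\<lambda>\<xi>. ennreal (sampling_density t \<xi>)) \<in> borel_measurable (points t)"
    using sampling_density_measurable[of t t] by measurable
  have m2: "(\<lambda>\<xi>. ennreal (sampling_density t \<xi>) * ennreal (sqnorm \<mu> (residual t \<xi> f))) \<in> borel_measurable (points t)"
    using m1 sqnorm_residual_measurable[OF order.refl f, of t] by measurable
  have upd: "residual (Suc t) (\<xi>(t := x)) f = kaczmarz_step (stepsize t) (step_kernel t \<xi>) x (residual t \<xi> f)" for \<xi> x
  proof -
    have "residual t (\<xi>(t := x)) f = residual t \<xi> f" "step_kernel t (\<xi>(t := x)) = step_kernel t \<xi>"
      by (auto intro!: residual_cong step_kernel_cong)
    then show ?thesis by (simp add: residual_Suc)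
  qed
  have "(\<integral>\<^sup>+\<xi>. ennreal (sampling_density (Suc t) \<xi>) * ennreal (sqnorm \<mu> (residual (Suc t) \<xi> f)) \<partial>points (Suc t)) =
      (\<integral>\<^sup>+\<xi>. ennreal (sampling_density t \<xi>) * (\<integral>\<^sup>+x. ennreal (step_kernel t \<xi> x x / step_rank t) *
        ennreal (sqnorm \<mu> (kaczmarz_step (stepsize t) (step_kernel t \<xi>) x (residual t \<xi> f))) \<partial>\<mu>) \<partial>points t)"
    unfolding points_Suc_integral[OF m] upd ..
  also have "\<dots> \<le> (\<integral>\<^sup>+\<xi>. ennreal c * (ennreal (sampling_density t \<xi>) * ennreal (sqnorm \<mu> (residual t \<xi> f))) +
      ennreal d * ennreal (sampling_density t \<xi>) \<partial>points t)"
  proof (rule nn_integral_mono)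
    fix \<xi>
    show "ennreal (sampling_density t \<xi>) * (\<integral>\<^sup>+x. ennreal (step_kernel t \<xi> x x / step_rank t) *
        ennreal (sqnorm \<mu> (kaczmarz_step (stepsize t) (step_kernel t \<xi>) x (residual t \<xi> f))) \<partial>\<mu>)
      \<le> ennreal c * (ennreal (sampling_density t \<xi>) * ennreal (sqnorm \<mu> (residual t \<xi> f))) + ennreal d * ennreal (sampling_density t \<xi>)"
    proof (cases "sampling_density t \<xi> = 0")
      case False
      have "ennreal c * (ennreal (sampling_density t \<xi>) * ennreal (sqnorm \<mu> (residual t \<xi> f))) + ennreal d * ennreal (sampling_density t \<xi>) =
          ennreal (sampling_density t \<xi>) * ennreal (c * sqnorm \<mu> (residual t \<xi> f) + d)"
        using c d by (simp add: ennreal_mult ennreal_plus algebra_simps)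
      then show ?thesis using mult_left_mono[OF step[OF False], of "ennreal (sampling_density t \<xi>)"] by simp
    qed simp
  qed
  also have "\<dots> = ennreal c * (\<integral>\<^sup>+\<xi>. ennreal (sampling_density t \<xi>) * ennreal (sqnorm \<mu> (residual t \<xi> f)) \<partial>points t) +
      ennreal d * (\<integral>\<^sup>+\<xi>. ennreal (sampling_density t \<xi>) \<partial>points t)"
    using m1 m2 by (subst nn_integral_add) (auto simp: nn_integral_cmult)
  also have "\<dots> \<le> ennreal c * ennreal b + ennreal d * 1"
    unfolding sampling_density_total by (intro add_mono mult_left_mono IH) auto
  also have "\<dots> = ennreal (c * b + d)" using b c d by (simp add: ennreal_mult ennreal_plus)
  finally show ?thesis .
qed

text \<open>With a kernel of dimension \<open>k - t\<close>, a step of size \<open>1\<close> multiplies the expected squared norm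
  by at most \<open>1 + 1 / (k - t)\<close>, and these factors telescope.\<close>

lemma expected_deflation:
  assumes f: "f \<in> L2 \<mu>" and t: "t \<le> k"
  defines "g \<equiv> remainder \<mu> k \<eta> f"
  shows "(\<integral>\<^sup>+\<xi>. ennreal (sampling_density t \<xi>) * ennreal (sqnorm \<mu> (residual t \<xi> g)) \<partial>points t)
    \<le> ennreal (real (k + 1) / real (k + 1 - t) * sqnorm \<mu> g)"
  using t
proof (induction t)
  case 0
  then show ?case by (simp add: residual_0 sampling_density_def PiM_empty)
next
  case (Suc t)
  have g: "g \<in> L2 \<mu>" unfolding g_def by (rule remainder_L2[OF orthonormal f])
  have tk: "t < k" using Suc.prems by simp
  have eq: "step_kernel t \<xi> = deflated t \<xi>" "stepsize t = 1" "step_rank t = real (k - t)" for \<xi>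
    using tk by (simp_all add: step_kernel_def stepsize_def step_rank_def)
  have zero: "kernel_op \<mu> (step_kernel t \<xi>) (residual t \<xi> g) y = 0" for \<xi> y
    unfolding eq g_def using tk by (intro kernel_op_deflated_residual_remainder f) simp
  have "(\<integral>\<^sup>+\<xi>. ennreal (sampling_density (Suc t) \<xi>) * ennreal (sqnorm \<mu> (residual (Suc t) \<xi> g)) \<partial>points (Suc t))
    \<le> ennreal ((1 + 1 / real (k - t)) * (real (k + 1) / real (k + 1 - t) * sqnorm \<mu> g) + 0)"
  proof (rule expected_step[OF g])
    fix \<xi> assume "sampling_density t \<xi> \<noteq> 0"
    from expected_sqnorm_step[OF step_kernel_projection_kernel step_kernel_trace[OF this] step_rank_pos residual_L2[OF g], of t \<xi> "stepsize t"]
    show "(\<integral>\<^sup>+x. ennreal (step_kernel t \<xi> x x / step_rank t) *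
        ennreal (sqnorm \<mu> (kaczmarz_step (stepsize t) (step_kernel t \<xi>) x (residual t \<xi> g))) \<partial>\<mu>)
      \<le> ennreal ((1 + 1 / real (k - t)) * sqnorm \<mu> (residual t \<xi> g) + 0)"
      unfolding zero unfolding eq by simp
  qed (use Suc tk in auto)
  also have "(1 + 1 / real (k - t)) * (real (k + 1) / real (k + 1 - t) * sqnorm \<mu> g) + 0 =
      real (k + 1) / real (k + 1 - Suc t) * sqnorm \<mu> g"
  proof -
    have "1 + 1 / real (k - t) = real (k + 1 - t) / real (k - t)"
      using tk by (simp add: field_simps)
    then show ?thesis using tk by simp
  qed
  finally show ?case .
qed

lemma excess_nonneg: "0 \<le> excess i"
proof (induction i)
  case (Suc i)
  have "(excess i)\<^sup>2 \<le> excess i * (real k * (1 + excess i))"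
  proof -
    have "1 * excess i \<le> real k * (1 + excess i)" using k_pos Suc by (intro mult_mono) auto
    then have "excess i * excess i \<le> excess i * (real k * (1 + excess i))" using Suc by (intro mult_left_mono) auto
    then show ?thesis by (simp add: power2_eq_square)
  qed
  moreover have "0 < real k * (1 + excess i)" using k_pos Suc by simp
  ultimately show ?case by (simp add: field_simps)
qed simp

text \<open>
  After deflation the residual of \<open>f\<close> is that of its orthogonal part, which gives the initial
  excess \<open>k\<close>. From then on \<open>expected_sqnorm_step\<close> applies with Pythagoras for the
  mixed term: the component in the subspace contracts, at the price of noise proportional to \<open>a\<^sup>2 / k\<close>.
\<close>

lemma expected_kaczmarz:
  assumes f: "f \<in> L2 \<mu>"
  defines "G \<equiv> sqnorm \<mu> (remainder \<mu> k \<eta> f)"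
  shows "(\<integral>\<^sup>+\<xi>. ennreal (sampling_density (k + i) \<xi>) * ennreal (sqnorm \<mu> (residual (k + i) \<xi> f)) \<partial>points (k + i))
    \<le> ennreal ((1 + excess i) * G)"
proof (induction i)
  case 0
  have "(\<integral>\<^sup>+\<xi>. ennreal (sampling_density k \<xi>) * ennreal (sqnorm \<mu> (residual k \<xi> f)) \<partial>points k) =
     (\<integral>\<^sup>+\<xi>. ennreal (sampling_density k \<xi>) * ennreal (sqnorm \<mu> (residual k \<xi> (remainder \<mu> k \<eta> f))) \<partial>points k)"
    by (rule nn_integral_cong) (metis ennreal_0 f mult_zero_left residual_after_deflation)
  also have "\<dots> \<le> ennreal ((1 + excess 0) * G)"
    using expected_deflation[OF f order.refl] by (simp add: G_def add.commute)
  finally show ?case by simp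
next
  case (Suc i)
  define a where "a = stepsize (k + i)"
  define u where "u = excess i"
  have u: "u \<ge> 0" by (simp add: u_def excess_nonneg)
  have a: "a = u / (1 + u)" by (simp add: a_def u_def stepsize_def)
  have G: "G \<ge> 0" by (simp add: G_def)
  have eq: "step_kernel (k + i) \<xi> = basis_kernel k \<eta>" "step_rank (k + i) = real k" for \<xi>
    by (simp_all add: step_kernel_def step_rank_def)
  have k: "real k \<ge> 1" using k_pos by simp
  have c: "0 \<le> 1 + a\<^sup>2 / k - 2 * a / k"
  proof -
    have "0 \<le> (real k - 1) + (1 - a)\<^sup>2" using k by simp
    also have "\<dots> = real k + a\<^sup>2 - 2 * a" by (simp add: power2_eq_square algebra_simps)
    finally have "0 \<le> (real k + a\<^sup>2 - 2 * a) / k" by simp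
    also have "\<dots> = 1 + a\<^sup>2 / k - 2 * a / k" using k by (simp add: add_divide_distrib diff_divide_distrib)
    finally show ?thesis .
  qed
  have "(\<integral>\<^sup>+\<xi>. ennreal (sampling_density (Suc (k + i)) \<xi>) * ennreal (sqnorm \<mu> (residual (Suc (k + i)) \<xi> f)) \<partial>points (Suc (k + i)))
    \<le> ennreal ((1 + a\<^sup>2 / k - 2 * a / k) * ((1 + u) * G) + 2 * a / k * G)"
  proof (rule expected_step[OF f _ c])
    fix \<xi> assume "sampling_density (k + i) \<xi> \<noteq> 0"
    note * = integral_mult_kernel_op_basis[OF orthonormal residual_L2[OF f, of "k + i" \<xi>]]
    from expected_sqnorm_step[OF projection_kernel_basis[OF orthonormal] has_trace_basis[OF orthonormal] _ residual_L2[OF f] *(1), of a]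
    show "(\<integral>\<^sup>+x. ennreal (step_kernel (k + i) \<xi> x x / step_rank (k + i)) *
        ennreal (sqnorm \<mu> (kaczmarz_step (stepsize (k + i)) (step_kernel (k + i) \<xi>) x (residual (k + i) \<xi> f))) \<partial>\<mu>)
      \<le> ennreal ((1 + a\<^sup>2 / k - 2 * a / k) * sqnorm \<mu> (residual (k + i) \<xi> f) + 2 * a / k * G)"
      using k unfolding eq *(2) remainder_residual[OF f] G_def[symmetric] a_def[symmetric]
      by (simp add: algebra_simps)
  qed (use u a G k Suc in \<open>auto simp: u_def\<close>)
  also have "(1 + a\<^sup>2 / k - 2 * a / k) * ((1 + u) * G) + 2 * a / k * G = (1 + excess (Suc i)) * G"
  proof -
    have "a * (1 + u) = u" using u by (simp add: a)
    then have au: "a + a * u = u" by (simp add: algebra_simps)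
    have "(1 + a\<^sup>2 / k - 2 * a / k) * (1 + u) + 2 * a / k =
        1 + u + (a * (a + a * u) - 2 * (a + a * u) + 2 * a) / k"
      using k by (simp add: field_simps power2_eq_square)
    also have "\<dots> = 1 + u - u * a / k" using au k by (simp add: field_simps)
    also have "\<dots> = 1 + excess (Suc i)" using u k by (simp add: a u_def[symmetric] power2_eq_square)
    finally show ?thesis by (metis (no_types, opaque_lifting) distrib_right mult.assoc)
  qed
  finally show ?case by simp
qed

section \<open>The number of steps\<close>

lemma excess_antimono: "excess (Suc i) \<le> excess i"
  using excess_nonneg[of i] by simp

lemma excess_Suc_le:
  assumes "excess i \<le> c" "0 < c"
  shows "excess (Suc i) \<le> excess i - (excess i)\<^sup>2 / (real k * (1 + c))"
proof -
  have "0 < real k * (1 + excess i)" "real k * (1 + excess i) \<le> real k * (1 + c)"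
    using k_pos excess_nonneg[of i] assms by (auto intro!: mult_left_mono)
  then have "(excess i)\<^sup>2 / (real k * (1 + c)) \<le> (excess i)\<^sup>2 / (real k * (1 + excess i))"
    by (intro divide_left_mono) auto
  then show ?thesis by simp
qed

text \<open>Above \<open>1\<close> the excess shrinks by a constant factor per \<open>2 k\<close> steps, because then
  \<open>u / (1 + u) \<ge> 1 / 2\<close>.\<close>

lemma excess_geometric: "excess i \<le> 1 \<or> excess i \<le> real k * (1 - 1 / (2 * real k)) ^ i"
proof (induction i)
  case (Suc i)
  show ?case
  proof (cases "excess i \<le> 1")
    case True
    then show ?thesis using excess_antimono[of i] by linarith
  next
    case False
    then have u: "1 < excess i" by simp
    have k: "real k \<ge> 1" using k_pos by simp
    have "excess (Suc i) \<le> excess i - (excess i)\<^sup>2 / (real k * (1 + excess i))"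
      using u by (intro excess_Suc_le) auto
    also have "\<dots> \<le> excess i - (excess i)\<^sup>2 / (real k * (2 * excess i))"
      using u k by (intro diff_left_mono divide_left_mono mult_left_mono) auto
    also have "\<dots> = (1 - 1 / (2 * real k)) * excess i"
      using u k by (simp add: power2_eq_square field_simps)
    also have "\<dots> \<le> (1 - 1 / (2 * real k)) * (real k * (1 - 1 / (2 * real k)) ^ i)"
      using Suc False k by (intro mult_left_mono) (auto simp: field_simps)
    finally show ?thesis by (simp add: mult_ac)
  qed
qed simp

text \<open>Below \<open>1\<close> the recursion is dominated by \<open>u \<mapsto> u - u\<^sup>2 / (2 k)\<close>, whose reciprocal grows by
  at least \<open>1 / (2 k)\<close> per step.\<close>

lemma excess_harmonic:
  assumes "excess N \<le> 1"
  shows "excess (N + i) \<le> 2 * real k / (real i + 2 * real k)"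
proof (induction i)
  case 0
  then show ?case using assms k_pos by simp
next
  case (Suc i)
  define c where "c = real i + 2 * real k"
  define x where "x = 2 * real k / c"
  define u where "u = excess (N + i)"
  have k: "real k \<ge> 1" using k_pos by simp
  have c: "c > 0" using k by (simp add: c_def)
  have x: "x \<le> 1" using c by (simp add: x_def c_def)
  have u: "0 \<le> u" "u \<le> x" using Suc excess_nonneg[of "N + i"] by (simp_all add: u_def x_def c_def)
  have "excess (N + Suc i) \<le> u - u\<^sup>2 / (2 * real k)"
    using excess_Suc_le[of "N + i" 1] u x by (simp add: u_def mult.commute)
  also have "\<dots> \<le> x - x\<^sup>2 / (2 * real k)"
  proof -
    have "(x + u) * (x - u) \<le> (2 * real k) * (x - u)" using u x k by (intro mult_right_mono) auto
    then have "x\<^sup>2 - u\<^sup>2 \<le> (2 * real k) * (x - u)" by (simp add: power2_eq_square algebra_simps)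
    then have "(x\<^sup>2 - u\<^sup>2) / (2 * real k) \<le> x - u" using k by (simp add: divide_le_eq mult.commute)
    then show ?thesis by (simp add: diff_divide_distrib)
  qed
  also have "\<dots> = 2 * real k * (c - 1) / c\<^sup>2"
    using c k by (simp add: x_def power2_eq_square field_simps)
  also have "\<dots> \<le> 2 * real k / (c + 1)"
  proof -
    have "(c - 1) * (c + 1) \<le> c\<^sup>2" by (simp add: power2_eq_square algebra_simps)
    then have "(c - 1) / c\<^sup>2 \<le> 1 / (c + 1)" using c by (simp add: field_simps)
    then have "2 * real k * ((c - 1) / c\<^sup>2) \<le> 2 * real k * (1 / (c + 1))" by (intro mult_left_mono) auto
    then show ?thesis by simp
  qed
  finally show ?case by (simp add: c_def add_ac)
qed

text \<open>About \<open>2 k ln k\<close> steps bring the excess from \<open>k\<close> down to \<open>1\<close>. Together with the \<open>k\<close>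
  deflation steps this uses less than half of the \<open>n\<close> points; the other half yields \<open>4 k / n\<close>.\<close>

lemma excess_bound:
  assumes n: "1 \<le> n" and budget: "real k * (48 * (sqrt 2 * ln (2 * real n))) \<le> real n"
  shows "k \<le> n" "excess (n - k) \<le> 4 * real k / real n"
proof -
  define L where "L = ln (2 * real n)"
  have k: "real k \<ge> 1" using k_pos by simp
  have "ln 2 \<le> L" unfolding L_def using n by simp
  then have L: "2 / 3 \<le> L" using ln2_ge_two_thirds by linarith
  have "1 * L \<le> sqrt 2 * L" using L by (intro mult_right_mono) auto
  then have "real k * (48 * L) \<le> real k * (48 * (sqrt 2 * L))" by (intro mult_left_mono) auto
  then have kL: "48 * (real k * L) \<le> real n" using budget unfolding L_def by linarith
  have kL1: "2 / 3 * real k \<le> real k * L" using mult_left_mono[OF L, of "real k"] by simp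
  show kn: "k \<le> n" using kL kL1 by linarith
  define N where "N = nat \<lceil>2 * real k * ln (real k)\<rceil>"
  have N: "2 * real k * ln (real k) \<le> real N" "real N \<le> 2 * real k * ln (real k) + 1"
  proof -
    have "0 \<le> 2 * real k * ln (real k)" using k by simp
    then show "2 * real k * ln (real k) \<le> real N" "real N \<le> 2 * real k * ln (real k) + 1"
      unfolding N_def by linarith+
  qed
  have "ln (real k) \<le> L" unfolding L_def using kn k by simp
  then have "2 * real k * ln (real k) \<le> 2 * (real k * L)" using k by simp
  then have half: "real k + real N \<le> real n / 2" using N(2) kL kL1 k by linarith
  have "real k * (1 - 1 / (2 * real k)) ^ N \<le> 1"
  proof -
    have "(1 - 1 / (2 * real k)) ^ N \<le> exp (- (1 / (2 * real k))) ^ N"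
      using k exp_ge_add_one_self[of "- (1 / (2 * real k))"] by (intro power_mono) (auto simp: field_simps)
    also have "\<dots> = exp (- (real N / (2 * real k)))" by (simp add: exp_of_nat_mult[symmetric])
    also have "\<dots> \<le> exp (- ln (real k))"
      using N(1) k by (simp add: field_simps)
    also have "\<dots> = 1 / real k" using k by (simp add: exp_minus inverse_eq_divide)
    finally show ?thesis using k by (simp add: field_simps)
  qed
  then have "excess N \<le> 1" using excess_geometric[of N] by linarith
  then have "excess (N + (n - k - N)) \<le> 2 * real k / (real (n - k - N) + 2 * real k)"
    by (rule excess_harmonic)
  also have "\<dots> \<le> 2 * real k / (real n / 2)"
    using half k n by (intro divide_left_mono) auto
  also have "\<dots> = 4 * real k / real n" by simp
  finally show "excess (n - k) \<le> 4 * real k / real n" using half by simp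
qed

section \<open>The algorithm as a randomized algorithm\<close>

lemma L2_dist_sum:
  "L2_dist \<mu> (\<lambda>y. \<Sum>j<k. c j * \<eta> j y) (\<lambda>y. \<Sum>j<k. d j * \<eta> j y) = sqrt (\<Sum>j<k. (c j - d j)\<^sup>2)"
proof -
  have "L2_dist \<mu> (\<lambda>y. \<Sum>j<k. c j * \<eta> j y) (\<lambda>y. \<Sum>j<k. d j * \<eta> j y) =
      sqrt (sqnorm \<mu> (\<lambda>y. \<Sum>j<k. (c j - d j) * \<eta> j y))"
    by (simp add: L2_dist_def sum_subtractf left_diff_distrib)
  then show ?thesis by (simp only: orthonormal_sqnorm_sum[OF orthonormal])
qed

text \<open>The \<open>L2\<close> distance between two functions in the span is the Euclidean distance of their coefficients,
  so preimages of open sets are open in the product topology.\<close>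

lemma continuous_coefficients_measurable:
  assumes c: "\<And>j. continuous_on UNIV (\<lambda>a :: nat \<Rightarrow> real. c a j)"
  shows "(\<lambda>a y. \<Sum>j<k. c a j * \<eta> j y) \<in> borel_vec n \<rightarrow>\<^sub>M L2_borel \<mu>"
proof -
  have id: "(\<lambda>a. a) \<in> borel_vec n \<rightarrow>\<^sub>M borel"
  proof (rule measurable_coordinatewise_then_product)
    fix i :: nat
    show "(\<lambda>a. a i) \<in> borel_measurable (borel_vec n)"
    proof (cases "i < n")
      case False
      then have "(\<lambda>a. a i) \<in> borel_measurable (borel_vec n) \<longleftrightarrow>
          (\<lambda>_. undefined :: real) \<in> borel_measurable (borel_vec n)"
        by (intro measurable_cong) (auto simp: space_PiM PiE_def extensional_def)
      then show ?thesis by simp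
    qed (simp add: measurable_component_singleton)
  qed
  have "(\<lambda>a y. \<Sum>j<k. c a j * \<eta> j y) \<in> borel \<rightarrow>\<^sub>M L2_borel \<mu>"
    unfolding L2_borel_def
  proof (rule measurable_measure_of)
    let ?F = "\<lambda>(a :: nat \<Rightarrow> real) y. \<Sum>j<k. c a j * \<eta> j y"
    show "{U. L2_open \<mu> U} \<subseteq> Pow (L2 \<mu>)" by (auto simp: L2_open_def)
    have F: "?F a \<in> L2 \<mu>" for a by (intro L2_sum L2_cmult orthonormalD[OF orthonormal]) simp
    then show "?F \<in> space borel \<rightarrow> L2 \<mu>" by simp
    fix U assume "U \<in> {U. L2_open \<mu> U}"
    then have U: "L2_open \<mu> U" by simp
    have "open (?F -` U)"
      unfolding open_subopen[of "?F -` U"]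
    proof (intro ballI)
      fix b assume "b \<in> ?F -` U"
      then have "?F b \<in> U" by simp
      then obtain \<epsilon> where e: "\<epsilon> > 0" "\<And>h. h \<in> L2 \<mu> \<Longrightarrow> L2_dist \<mu> (?F b) h < \<epsilon> \<Longrightarrow> h \<in> U"
        using U unfolding L2_open_def by blast
      have "open {a. L2_dist \<mu> (?F b) (?F a) < \<epsilon>}"
        unfolding L2_dist_sum by (intro open_Collect_less continuous_intros c)
      moreover have "b \<in> {a. L2_dist \<mu> (?F b) (?F a) < \<epsilon>}" using e(1) by (simp add: L2_dist_sum)
      moreover have "{a. L2_dist \<mu> (?F b) (?F a) < \<epsilon>} \<subseteq> ?F -` U" using e(2) F by auto
      ultimately show "\<exists>T. open T \<and> b \<in> T \<and> T \<subseteq> ?F -` U" by blast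
    qed
    then show "?F -` U \<inter> space borel \<in> sets borel" by simp
  qed
  then show ?thesis by (rule measurable_compose[OF id])
qed

lemma approx_coefficients:
  "\<exists>c. (\<forall>j. continuous_on UNIV (\<lambda>a :: nat \<Rightarrow> real. c a j)) \<and>
     (\<forall>a. approx t \<xi> a = (\<lambda>y. \<Sum>j<k. c a j * \<eta> j y))"
proof (induction t)
  case 0
  then show ?case by (intro exI[of _ "\<lambda>_ _. 0"]) simp
next
  case (Suc t)
  then obtain c where c: "\<And>j. continuous_on UNIV (\<lambda>a :: nat \<Rightarrow> real. c a j)"
    "\<And>a. approx t \<xi> a = (\<lambda>y. \<Sum>j<k. c a j * \<eta> j y)" by blast
  define x where "x = \<xi> t"
  define e where "e j = (\<integral>y. \<eta> j y * step_kernel t \<xi> x y \<partial>\<mu>)" for j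
  define w where "w = stepsize t * inverse (step_kernel t \<xi> x x)"
  define d where "d a j = c a j + w * (a t - (\<Sum>i<k. c a i * \<eta> i x)) * e j" for a j
  have e: "step_kernel t \<xi> x y = (\<Sum>j<k. e j * \<eta> j y)" for y
    unfolding e_def
    using kernel_op_basis[OF orthonormal projection_kernelD(1)[OF step_kernel_projection_kernel]]
      kernel_op_basis_step_kernel[of t \<xi> x y] by metis
  have "continuous_on UNIV (\<lambda>a. d a j)" for j
    unfolding d_def by (intro continuous_intros c continuous_on_product_coordinates)
  moreover have "approx (Suc t) \<xi> a = (\<lambda>y. \<Sum>j<k. d a j * \<eta> j y)" for a
  proof
    fix y
    have "approx (Suc t) \<xi> a y = (\<Sum>j<k. c a j * \<eta> j y) +
        w * (a t - (\<Sum>i<k. c a i * \<eta> i x)) * (\<Sum>j<k. e j * \<eta> j y)"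
      by (simp add: c(2) e[symmetric] x_def[symmetric] w_def divide_inverse)
    then show "approx (Suc t) \<xi> a y = (\<Sum>j<k. d a j * \<eta> j y)"
      by (simp add: d_def sum.distrib distrib_right sum_distrib_left mult.assoc)
  qed
  ultimately show ?case by (intro exI[of _ d]) blast
qed

lemma approx_measurable: "approx t \<xi> \<in> borel_vec n \<rightarrow>\<^sub>M L2_borel \<mu>"
proof -
  obtain c where c: "\<And>j. continuous_on UNIV (\<lambda>a :: nat \<Rightarrow> real. c a j)"
    "\<And>a. approx t \<xi> a = (\<lambda>y. \<Sum>j<k. c a j * \<eta> j y)" using approx_coefficients[of t \<xi>] by blast
  have "approx t \<xi> = (\<lambda>a y. \<Sum>j<k. c a j * \<eta> j y)" using c(2) by blast
  then show ?thesis using continuous_coefficients_measurable[OF c(1)] by simp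
qed

definition sample_space :: "nat \<Rightarrow> (nat \<Rightarrow> 'a) measure" where
  "sample_space n = density (points n) (\<lambda>\<xi>. ennreal (sampling_density n \<xi>))"

lemma prob_space_sample_space: "prob_space (sample_space n)"
proof
  have "(\<lambda>\<xi>. ennreal (sampling_density n \<xi>)) \<in> borel_measurable (points n)"
    using sampling_density_measurable[of n n] by measurable
  then have "emeasure (sample_space n) (space (points n)) = (\<integral>\<^sup>+\<xi>. ennreal (sampling_density n \<xi>) \<partial>points n)"
    unfolding sample_space_def
    by (subst emeasure_density) (auto intro!: nn_integral_cong split: split_indicator)
  then show "emeasure (sample_space n) (space (sample_space n)) = 1"
    by (simp add: sampling_density_total sample_space_def)
qed

text \<open>Functionals beyond the \<open>n\<close>-th are never evaluated; they repeat the first point.\<close>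

definition algorithm ::
  "('f \<Rightarrow> 'a \<Rightarrow> real) \<Rightarrow> nat \<Rightarrow> (nat \<Rightarrow> 'a, 'a, 'f) ran_alg" where
  "algorithm APP n = \<lparr>ran_space = sample_space n,
     ran_func = (\<lambda>\<xi> j f. APP f (\<xi> (if j < n then j else 0))),
     ran_stop = (\<lambda>_ t _. t = n),
     ran_recon = (\<lambda>\<xi> t. approx t \<xi>)\<rparr>"

lemma ran_n_algorithm: "ran_n (algorithm APP n) f \<xi> = n"
  by (auto simp: ran_n_def algorithm_def intro!: Least_equality)

lemma L2_dist_algorithm:
  "L2_dist \<mu> (APP f) (ran_output (algorithm APP n) \<xi> f) = sqrt (sqnorm \<mu> (residual n \<xi> (APP f)))"
proof -
  have "ran_output (algorithm APP n) \<xi> f = approx n \<xi> (\<lambda>j. APP f (\<xi> j))"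
    unfolding ran_output_def ran_n_algorithm
    by (auto simp: algorithm_def info_def intro!: approx_cong)
  then show ?thesis by (simp add: L2_dist_def residual_def)
qed

lemma algorithm_valid:
  assumes APP: "\<And>f. APP f \<in> L2 \<mu>" and n: "1 \<le> n"
  shows "ran_algorithm \<mu> APP (Lambda_std (space \<mu>) APP) (algorithm APP n)"
  unfolding ran_algorithm_def
proof (intro conjI allI ballI)
  have [simp]: "ran_space (algorithm APP n) = sample_space n" by (simp add: algorithm_def)
  show "prob_space (ran_space (algorithm APP n))" by (simp add: prob_space_sample_space)
  show "ran_recon (algorithm APP n) \<xi> t \<in> borel_vec t \<rightarrow>\<^sub>M L2_borel \<mu>" for \<xi> t
    by (simp add: algorithm_def approx_measurable)
  show "\<exists>t. ran_stop (algorithm APP n) \<xi> t (info (ran_func (algorithm APP n) \<xi>) t f)" for \<xi> f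
    by (simp add: algorithm_def)
  show "ran_n (algorithm APP n) f \<in> ran_space (algorithm APP n) \<rightarrow>\<^sub>M count_space UNIV" for f
  proof -
    have "ran_n (algorithm APP n) f = (\<lambda>_. n)" by (rule ext) (rule ran_n_algorithm)
    then show ?thesis by simp
  qed
  show "(\<lambda>\<xi>. L2_dist \<mu> (APP f) (ran_output (algorithm APP n) \<xi> f)) \<in> borel_measurable (ran_space (algorithm APP n))" for f
    unfolding L2_dist_algorithm using sqnorm_residual_measurable[OF order.refl APP[of f], of n]
    by (simp add: sample_space_def)
  fix \<xi> j assume "\<xi> \<in> space (ran_space (algorithm APP n))"
  then have "\<xi> \<in> (\<Pi>\<^sub>E i\<in>{..<n}. space \<mu>)" by (simp add: sample_space_def space_PiM)
  moreover have "(if j < n then j else 0) \<in> {..<n}" using n by simp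
  ultimately have "\<xi> (if j < n then j else 0) \<in> space \<mu>" by (rule PiE_mem)
  moreover have "ran_func (algorithm APP n) \<xi> j = (\<lambda>f. APP f (\<xi> (if j < n then j else 0)))"
    by (simp add: algorithm_def)
  ultimately show "ran_func (algorithm APP n) \<xi> j \<in> Lambda_std (space \<mu>) APP"
    unfolding Lambda_std_def by blast
qed

lemma e_ran_le:
  fixes APP :: "'f::real_normed_vector \<Rightarrow> 'a \<Rightarrow> real"
  assumes APP: "\<And>f. APP f \<in> L2 \<mu>" and n: "k \<le> n" and \<sigma>: "0 \<le> \<sigma>"
    and rem: "\<And>f. norm f \<le> 1 \<Longrightarrow> sqnorm \<mu> (remainder \<mu> k \<eta> (APP f)) \<le> \<sigma>\<^sup>2"
  shows "e_ran \<mu> APP n (Lambda_std (space \<mu>) APP) \<le> ennreal (sqrt (1 + excess (n - k)) * \<sigma>)"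
proof -
  interpret S: prob_space "sample_space n" by (rule prob_space_sample_space)
  have n1: "1 \<le> n" using n k_pos by simp
  have sp: "ran_space (algorithm APP n) = sample_space n" by (simp add: algorithm_def)
  have "ran_card (algorithm APP n) \<le> ennreal (real n)"
    unfolding ran_card_def ran_n_algorithm sp by (rule SUP_least) (simp add: S.emeasure_space_1)
  then have "e_ran \<mu> APP n (Lambda_std (space \<mu>) APP) \<le> ran_error \<mu> APP (algorithm APP n)"
    unfolding e_ran_def using algorithm_valid[of APP n] APP n1 by (intro Inf_lower) blast
  also have "\<dots> \<le> ennreal (sqrt (1 + excess (n - k)) * \<sigma>)"
    unfolding ran_error_def
  proof (intro SUP_least ennsqrt_le)
    fix f :: 'f assume "f \<in> {f. norm f \<le> 1}"
    then have f: "sqnorm \<mu> (remainder \<mu> k \<eta> (APP f)) \<le> \<sigma>\<^sup>2" using rem by simp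
    have m: "(\<lambda>\<xi>. ennreal (sampling_density n \<xi>)) \<in> borel_measurable (points n)"
      "(\<lambda>\<xi>. ennreal (sqnorm \<mu> (residual n \<xi> (APP f)))) \<in> borel_measurable (points n)"
      using sampling_density_measurable[of n n] sqnorm_residual_measurable[OF order.refl APP[of f], of n] by measurable
    have "(\<integral>\<^sup>+\<xi>. ennreal ((L2_dist \<mu> (APP f) (ran_output (algorithm APP n) \<xi> f))\<^sup>2) \<partial>ran_space (algorithm APP n)) =
        (\<integral>\<^sup>+\<xi>. ennreal (sampling_density n \<xi>) * ennreal (sqnorm \<mu> (residual n \<xi> (APP f))) \<partial>points n)"
      unfolding sp L2_dist_algorithm sample_space_def using m by (simp add: nn_integral_density)
    also have "\<dots> \<le> ennreal ((1 + excess (n - k)) * sqnorm \<mu> (remainder \<mu> k \<eta> (APP f)))"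
      using expected_kaczmarz[OF APP[of f], of "n - k"] n by simp
    also have "\<dots> \<le> ennreal ((1 + excess (n - k)) * \<sigma>\<^sup>2)"
      using f excess_nonneg[of "n - k"] by (intro ennreal_leI mult_left_mono) auto
    also have "\<dots> = ennreal ((sqrt (1 + excess (n - k)) * \<sigma>)\<^sup>2)"
      using excess_nonneg[of "n - k"] by (simp add: power_mult_distrib)
    finally show "(\<integral>\<^sup>+\<xi>. ennreal ((L2_dist \<mu> (APP f) (ran_output (algorithm APP n) \<xi> f))\<^sup>2) \<partial>ran_space (algorithm APP n))
        \<le> ennreal ((sqrt (1 + excess (n - k)) * \<sigma>)\<^sup>2)" .
  qed (use \<sigma> excess_nonneg[of "n - k"] in auto)
  finally show ?thesis .
qed

end

section \<open>Comparison with the worst case error\<close>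

lemma weighted_measure_prob:
  assumes "approximation_setting D \<rho> APP"
  shows "prob_space (weighted_measure D \<rho>)" "space (weighted_measure D \<rho>) = D"
proof -
  have \<rho>: "\<rho> \<in> borel_measurable (lebesgue_on D)" "(\<integral>\<^sup>+x. ennreal (\<rho> x) \<partial>lebesgue_on D) = 1"
    using assms by (simp_all add: approximation_setting_def)
  show "prob_space (weighted_measure D \<rho>)"
  proof
    have \<rho>': "(\<lambda>x. ennreal (\<rho> x)) \<in> borel_measurable (lebesgue_on D)" using \<rho>(1) by measurable
    have "emeasure (weighted_measure D \<rho>) (space (lebesgue_on D)) = (\<integral>\<^sup>+x. ennreal (\<rho> x) \<partial>lebesgue_on D)"
      unfolding weighted_measure_def using \<rho>'
      by (subst emeasure_density) (auto intro!: nn_integral_cong split: split_indicator)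
    then show "emeasure (weighted_measure D \<rho>) (space (weighted_measure D \<rho>)) = 1"
      using \<rho>(2) by (simp add: weighted_measure_def)
  qed
  show "space (weighted_measure D \<rho>) = D" by (simp add: weighted_measure_def)
qed

theorem theorem2p2:
  fixes D :: "(real ^ 'd) set"
    and \<rho> :: "real ^ 'd \<Rightarrow> real"
    and APP :: "'f::{real_inner, complete_space} \<Rightarrow> real ^ 'd \<Rightarrow> real"
    and \<delta> :: real and m n :: nat
  assumes setting: "approximation_setting D \<rho> APP"
    and delta: "0 < \<delta>" "\<delta> < 1"
    and m_pos: "1 \<le> m" and n_pos: "1 \<le> n"
    and m_eq: "int m = \<lfloor>real n / (48 * (sqrt 2 * ln (2 * real n) - ln \<delta>))\<rfloor>"
  shows "e_ran (weighted_measure D \<rho>) APP n (Lambda_std D APP)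
    \<le> ennreal (sqrt (1 + 4 * real m / real n) * (1 / sqrt (1 - \<delta>)))
      * e_wor (weighted_measure D \<rho>) APP m Lambda_all"
proof -
  let ?\<mu> = "weighted_measure D \<rho>"
  have emb: "compact_embedding ?\<mu> APP" using setting by (simp add: approximation_setting_def)
  obtain k \<eta> \<sigma> where k: "1 \<le> k" "k \<le> m" and \<eta>: "orthonormal ?\<mu> k \<eta>" and \<sigma>: "0 \<le> \<sigma>"
    "ennreal \<sigma> \<le> e_wor ?\<mu> APP m Lambda_all"
    and rem: "\<And>f. norm f \<le> 1 \<Longrightarrow> sqnorm ?\<mu> (remainder ?\<mu> k \<eta> (APP f)) \<le> \<sigma>\<^sup>2"
    using near_optimal_subspace[OF emb weighted_measure_prob(1)[OF setting] m_pos] by metis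
  interpret kaczmarz ?\<mu> k \<eta>
    by (intro kaczmarz.intro kaczmarz_axioms.intro weighted_measure_prob(1)[OF setting] k(1) \<eta>)
  define q where "q = 48 * (sqrt 2 * ln (2 * real n) - ln \<delta>)"
  have q: "48 * (sqrt 2 * ln (2 * real n)) \<le> q" "0 < q"
  proof -
    have "ln \<delta> < 0" using delta by simp
    moreover have "0 \<le> sqrt 2 * ln (2 * real n)" using n_pos by simp
    ultimately show "48 * (sqrt 2 * ln (2 * real n)) \<le> q" "0 < q" by (auto simp: q_def)
  qed
  have "real m \<le> real n / q" using m_eq unfolding q_def by linarith
  then have "real m * q \<le> real n" using q(2) by (simp add: pos_le_divide_eq)
  moreover have "real k * (48 * (sqrt 2 * ln (2 * real n))) \<le> real m * q"
    using k q n_pos by (intro mult_mono) auto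
  ultimately have budget: "real k * (48 * (sqrt 2 * ln (2 * real n))) \<le> real n" by linarith
  note ex = excess_bound[OF n_pos budget]
  have "excess (n - k) \<le> 4 * real m / real n"
    by (rule order.trans[OF ex(2)]) (use k in \<open>simp add: divide_right_mono\<close>)
  then have "sqrt (1 + excess (n - k)) \<le> sqrt (1 + 4 * real m / real n) * 1" by simp
  also have "\<dots> \<le> sqrt (1 + 4 * real m / real n) * (1 / sqrt (1 - \<delta>))"
    using delta by (intro mult_left_mono) (auto simp: le_divide_eq)
  finally have C: "sqrt (1 + excess (n - k)) \<le> sqrt (1 + 4 * real m / real n) * (1 / sqrt (1 - \<delta>))" .
  have "e_ran ?\<mu> APP n (Lambda_std D APP) \<le> ennreal (sqrt (1 + excess (n - k)) * \<sigma>)"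
    using e_ran_le[OF compact_embeddingD(1)[OF emb] ex(1) \<sigma>(1) rem]
    by (simp add: weighted_measure_prob(2)[OF setting])
  also have "\<dots> \<le> ennreal (sqrt (1 + 4 * real m / real n) * (1 / sqrt (1 - \<delta>)) * \<sigma>)"
    by (intro ennreal_leI mult_right_mono C \<sigma>(1))
  also have "\<dots> = ennreal (sqrt (1 + 4 * real m / real n) * (1 / sqrt (1 - \<delta>))) * ennreal \<sigma>"
    using delta \<sigma>(1) by (intro ennreal_mult) auto
  also have "\<dots> \<le> ennreal (sqrt (1 + 4 * real m / real n) * (1 / sqrt (1 - \<delta>))) * e_wor ?\<mu> APP m Lambda_all"
    by (intro mult_left_mono \<sigma>(2)) simp
  finally show ?thesis .
qed

end
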